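(* Let $f_1,f_2:\mathbb{R}^2\to\mathbb{R}^2$ be $C^1$ functions, and let $D$ be the set of all solutions of the differential inclusion $\dot x\in\{f_1(x),f_2(x)\}$ (so there are no restrictions on switching from integral curves generated by one of $f_1,f_2$ to integral curves generated by the other). Suppose that $f_1$ has a hyperbolic singular point $a^*$ (a sink, a source or a saddle point) lying in a region where $f_2$ has no bounded solutions. Then there is a nonempty set $V\subset\mathbb{R}^2$ such that $\mathbb{R}^2\setminus V$ is one unbounded subset of $\mathbb{R}^2$ (that is, $\mathbb{R}^2\setminus V$ is unbounded and connected) and such that conditions (RS1) and (BV3) hold for $V$ and $D$.
   Context: Solutions. A solution of $\dot x\in\{f_1(x),f_2(x)\}$ is an absolutely continuous function $x:\mathbb{R}\to\mathbb{R}^2$ with $\dot x(t)\in\{f_1(x(t)),f_2(x(t))\}$ for almost every $t\in\mathbb{R}$. A singular (fixed) point $a^*$ of $f_1$ is a point with $f_1(a^* )=0$; it is hyperbolic if $Df_1(a^* )$ has no eigenvalue with zero real part. "$f_2$ has no bounded solutions" in a region means that no solution of $\dot x=f_2(x)$ stays in that (bounded) region for all time. Simple paths. For $a,b\in\mathbb{R}^2$, there is a path from $a$ to $b$ generated by $D$ if there are $v\in D$ and $t_0<t_1$ in $\mathbb{R}$ with $v(t_0)=a$, $v(t_1)=b$. It is a simple path if moreover $\dot v$ has finitely many discontinuities on $[t_0,t_1]$ and $v(t)\neq a$, $v(t)\neq b$ for all $t_0<t<t_1$. The path, denoted $P_{ab}$, or $P_{ab}(t)=v(t)$ for $t_0\le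 t\le t_1$, is the set $\{v(t):t_0\le t\le t_1\}$ oriented by increasing time; it is in $V$ if this set is contained in $V$. Concatenation. Let $a_1,a_2,a_3,\ldots\in\mathbb{R}^2$ and let $P_{a_1a_2},P_{a_2a_3},\ldots$ be paths generated by $D$, with times $t_{a_1}<t_{a_2}<t_{a_3}<\ldots$ such that $P_{a_1a_2}(t_{a_1})=a_1$, $P_{a_1a_2}(t_{a_2})=a_2=P_{a_2a_3}(t_{a_2})$, $P_{a_2a_3}(t_{a_3})=a_3$, etc. There is a concatenation of these paths generated by $D$ if there is a solution $\gamma\in D$ with $\gamma(t)=P_{a_ia_{i+1}}(t)$ for $t_{a_i}\le t\le t_{a_{i+1}}$, for every $i$; the concatenation is the path $\{\gamma(t):t_{a_1}\le t\le\ldots\}$. (RS1) For every $a,b\in V$ there is a simple path from $a$ to $b$ in $V$ generated by $D$. (BV3) There are all concatenations (of finite or infinite sequences $P_{a_1a_2},P_{a_2a_3},\ldots$) of the simple paths specified in (RS1), i.e. simple paths in $V$ between points of $V$ generated by $D$, generated by $D$. *)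

theory Defs
  imports "HOL-Analysis.Analysis" "HOL-Library.Extended_Nat"
begin

definition C1_map :: "('a::real_normed_vector \<Rightarrow> 'b::real_normed_vector) \<Rightarrow> bool" where
  "C1_map f \<longleftrightarrow>
     (\<exists>f' :: 'a \<Rightarrow> 'a \<Rightarrow>\<^sub>L 'b.
        (\<forall>x. (f has_derivative blinfun_apply (f' x)) (at x)) \<and> continuous_on UNIV f')"

text \<open>The elements of a division are nonempty, compact, pairwise nonoverlapping intervals;
  the intervals need not cover \<open>{a..b}\<close>, since \<open>T\<close> is arbitrary.\<close>

definition absolutely_continuous_on_interval ::
  "real \<Rightarrow> real \<Rightarrow> (real \<Rightarrow> 'a::metric_space) \<Rightarrow> bool" where
  "absolutely_continuous_on_interval a b x \<longleftrightarrow>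
     (\<forall>\<epsilon>>0. \<exists>\<delta>>0. \<forall>\<D> T.
        \<D> division_of T \<and> T \<subseteq> {a..b} \<and> (\<Sum>K\<in>\<D>. Sup K - Inf K) < \<delta>
          \<longrightarrow> (\<Sum>K\<in>\<D>. dist (x (Inf K)) (x (Sup K))) < \<epsilon>)"

text \<open>Absolute continuity of a function on the whole line is meant on every compact interval,
  as is usual for solutions of differential inclusions (otherwise even \<open>x' = x\<close> would only have
  the zero solution).\<close>

definition inclusion_solution :: "('a::real_normed_vector \<Rightarrow> 'a set) \<Rightarrow> (real \<Rightarrow> 'a) \<Rightarrow> bool" where
  "inclusion_solution F x \<longleftrightarrow>
     (\<forall>a b. absolutely_continuous_on_interval a b x) \<and>
     (AE t in lebesgue. \<exists>y\<in>F (x t). (x has_vector_derivative y) (at t))"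

definition inclusion_solutions ::
  "('a::real_normed_vector \<Rightarrow> 'a) \<Rightarrow> ('a \<Rightarrow> 'a) \<Rightarrow> (real \<Rightarrow> 'a) set" where
  "inclusion_solutions f1 f2 = {x. inclusion_solution (\<lambda>p. {f1 p, f2 p}) x}"

definition singular_point :: "('a::real_normed_vector \<Rightarrow> 'a) \<Rightarrow> 'a \<Rightarrow> bool" where
  "singular_point f a \<longleftrightarrow> f a = 0"

text \<open>Eigenvalues of a real matrix are taken over the complex numbers.\<close>

definition complex_eigenvalue :: "real^'n^'n \<Rightarrow> complex \<Rightarrow> bool" where
  "complex_eigenvalue A \<mu> \<longleftrightarrow> (\<exists>w. w \<noteq> 0 \<and> map_matrix complex_of_real A *v w = \<mu> *s w)"

definition hyperbolic_singular_point :: "(real^'n \<Rightarrow> real^'n) \<Rightarrow> real^'n \<Rightarrow> bool" where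
  "hyperbolic_singular_point f a \<longleftrightarrow>
     singular_point f a \<and> (\<forall>\<mu>. complex_eigenvalue (jacobian f (at a)) \<mu> \<longrightarrow> Re \<mu> \<noteq> 0)"

definition ode_solution :: "('a::real_normed_vector \<Rightarrow> 'a) \<Rightarrow> (real \<Rightarrow> 'a) \<Rightarrow> bool" where
  "ode_solution f x \<longleftrightarrow> (\<forall>t. (x has_vector_derivative f (x t)) (at t))"

definition no_bounded_solutions_in :: "('a::real_normed_vector \<Rightarrow> 'a) \<Rightarrow> 'a set \<Rightarrow> bool" where
  "no_bounded_solutions_in f U \<longleftrightarrow> \<not> (\<exists>x. ode_solution f x \<and> (\<forall>t. x t \<in> U))"

text \<open>\<open>v\<close> generates, on the time interval \<open>{t0..t1}\<close>, a simple path from \<open>a\<close> to \<open>b\<close> in \<open>V\<close>.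
  Finitely many discontinuities of the derivative means: off a finite set of times, the
  derivative exists and is continuous. The case \<open>a = b\<close> is allowed.\<close>

definition simple_path_in ::
  "(real \<Rightarrow> 'a::real_normed_vector) set \<Rightarrow> 'a set \<Rightarrow> 'a \<Rightarrow> 'a \<Rightarrow> (real \<Rightarrow> 'a) \<Rightarrow> real \<Rightarrow> real \<Rightarrow> bool"
where
  "simple_path_in D V a b v t0 t1 \<longleftrightarrow>
     v \<in> D \<and> t0 < t1 \<and> v t0 = a \<and> v t1 = b \<and>
     v piecewise_C1_differentiable_on {t0..t1} \<and>
     (\<forall>t. t0 < t \<and> t < t1 \<longrightarrow> v t \<noteq> a \<and> v t \<noteq> b) \<and>
     v ` {t0..t1} \<subseteq> V"

definition RS1 :: "(real \<Rightarrow> 'a::real_normed_vector) set \<Rightarrow> 'a set \<Rightarrow> bool" where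
  "RS1 D V \<longleftrightarrow> (\<forall>a\<in>V. \<forall>b\<in>V. \<exists>v t0 t1. simple_path_in D V a b v t0 t1)"

text \<open>\<open>N\<close> is the number of paths being concatenated (\<open>N = \<infinity>\<close> for an infinite sequence). The
  \<open>i\<close>-th path goes from \<open>a i\<close> to \<open>a (Suc i)\<close> and is parametrized by \<open>P i\<close> on
  \<open>{t i..t (Suc i)}\<close>. The increasing times \<open>t i\<close> of an infinite sequence may be bounded.\<close>

definition BV3 :: "(real \<Rightarrow> 'a::real_normed_vector) set \<Rightarrow> 'a set \<Rightarrow> bool" where
  "BV3 D V \<longleftrightarrow>
     (\<forall>(N::enat) (a :: nat \<Rightarrow> 'a) (t :: nat \<Rightarrow> real) (P :: nat \<Rightarrow> real \<Rightarrow> 'a).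
        0 < N \<and> (\<forall>i. enat i < N \<longrightarrow> simple_path_in D V (a i) (a (Suc i)) (P i) (t i) (t (Suc i)))
        \<longrightarrow> (\<exists>\<gamma>\<in>D. \<forall>i. enat i < N \<longrightarrow> (\<forall>s\<in>{t i..t (Suc i)}. \<gamma> s = P i s)))"

end

theory Submission
  imports Defs
begin

text \<open>The set \<open>V\<close> is a small filled-in closed curve near the singular point \<open>a\<close> of \<open>f1\<close>.

The constant curve at \<open>a\<close> stays in the region around \<open>a\<close>, so it is not a solution of
\<open>x' = f2 x\<close>, and \<open>w = f2 a\<close> is not \<open>0\<close>. Near \<open>a\<close> the field \<open>f2\<close> is almost the constant \<open>w\<close>, whereas \<open>f1\<close> is almost
linear with an invertible derivative \<open>A\<close>, because by hyperbolicity \<open>0\<close> is not an eigenvalue.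
Hence on a small ball around \<open>a - s A\<^sup>-\<^sup>1 w\<close> the field \<open>f1\<close> is almost
\<open>- s w\<close>, that is, opposed to \<open>f2\<close>, and moving the point in the direction that \<open>A\<close> maps to the
normal of \<open>w\<close> makes \<open>f1\<close> deviate from the line of \<open>f2\<close> to either side
(\<open>opposed_fields_near_singular_point\<close>).

In such a ball there is a closed curve made of one arc of \<open>f2\<close> and one arc of \<open>f1\<close>
(\<open>two_field_loop\<close>). Rescale both fields so that their component along \<open>w\<close> is \<open>1\<close>, which reverses
\<open>f1\<close>, and start both flows at the same point \<open>q\<close>. After a short time \<open>h\<close> the two end points are at
the same height along \<open>w\<close>, and the sign of the gap between them is the side to which the fields
deviate from each other at \<open>q\<close>. The gap depends continuously on \<open>q\<close> and takes both signs, so it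
vanishes for some \<open>q\<close>: the arc of \<open>f2\<close> from \<open>q\<close> to the common end point and the arc of \<open>f1\<close> back to \<open>q\<close> form a closed
curve.

Any two points of this closed curve \<open>K\<close> can be joined along \<open>K\<close>. Let \<open>V\<close> be \<open>K\<close> together with the
bounded components of its complement, so that the complement of \<open>V\<close> is the unbounded component.
As \<open>f2\<close> has a positive component along \<open>w\<close>, its integral curves, followed forwards or
backwards, have to leave \<open>V\<close> and meet \<open>K\<close> before they do; so any two points of \<open>V\<close> can be joined in
\<open>V\<close> (\<open>filled_all_reach\<close>).

Finally, mutual reachability in a compact set with at least two points gives (RS1) and (BV3).
Closed runs extend periodically to global solutions, and cutting a run at its last departure and
first arrival makes it simple (\<open>RS1_if_all_reach\<close>). A concatenation is Lipschitz, because the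
fields are bounded on \<open>V\<close>; if its times accumulate, it therefore has a limit, which lies in the
closed set \<open>V\<close>, and can be continued from there (\<open>BV3_if_all_reach\<close>).\<close>

section \<open>Integral curves of a Lipschitz field\<close>

lemma first_hit:
  fixes x :: "real \<Rightarrow> 'a::metric_space"
  assumes "continuous_on {a..b} x" "a \<le> b" "closed A" "x b \<in> A"
  obtains t where "t \<in> {a..b}" "x t \<in> A" "\<And>s. s \<in> {a..<t} \<Longrightarrow> x s \<notin> A"
proof -
  let ?H = "{a..b} \<inter> x -` A"
  have "closed ?H" by (rule continuous_closed_preimage) (use assms in auto)
  moreover have "?H \<noteq> {}" using assms by auto
  moreover have bdd: "bdd_below ?H" by (rule bdd_belowI[of _ a]) auto
  ultimately have "Inf ?H \<in> ?H" by (intro closed_contains_Inf)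
  moreover have "x s \<notin> A" if "s \<in> {a..<Inf ?H}" for s
  proof
    assume "x s \<in> A"
    then have "s \<in> ?H" using that \<open>Inf ?H \<in> ?H\<close> by auto
    from cInf_lower[OF this bdd] that show False by simp
  qed
  ultimately show thesis using that by auto
qed

lemma last_hit:
  fixes x :: "real \<Rightarrow> 'a::metric_space"
  assumes x: "continuous_on {a..b} x" "a \<le> b" "closed A" "x a \<in> A"
  obtains t where "t \<in> {a..b}" "x t \<in> A" "\<And>s. s \<in> {t<..b} \<Longrightarrow> x s \<notin> A"
proof -
  have "continuous_on {- b..- a} (\<lambda>t. x (- t))"
    by (rule continuous_on_compose2[OF x(1)]) (auto intro!: continuous_intros)
  then obtain t where t: "t \<in> {- b..- a}" "x (- t) \<in> A" "\<And>s. s \<in> {- b..<t} \<Longrightarrow> x (- s) \<notin> A"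
    by (rule first_hit[of "- b" "- a" "\<lambda>t. x (- t)" A]) (use x in auto)
  have "x s \<notin> A" if "s \<in> {- t<..b}" for s
    using t(3)[of "- s"] that by auto
  with t show thesis by (intro that[of "- t"]) auto
qed

lemma integral_exp_weight:
  fixes K :: real
  assumes "0 < K" "0 \<le> s"
  shows "((\<lambda>r. exp (K * r)) has_integral (exp (K * s) - 1) / K) {0..s}"
proof -
  have "((\<lambda>r. exp (K * r)) has_integral exp (K * s) / K - exp (K * 0) / K) {0..s}"
    using assms
    by (intro fundamental_theorem_of_calculus)
      (auto intro!: derivative_eq_intros simp: has_real_derivative_iff_has_vector_derivative[symmetric])
  then show ?thesis by (simp add: diff_divide_distrib)
qed

text \<open>The Picard operator, written for \<open>u t = exp (- K t) (x t - p)\<close>, contracts the supremum norm on the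
whole half-line once \<open>K\<close> is at least twice the Lipschitz constant. With the weight, one fixed point
gives a solution for all positive times.\<close>

lemma global_forward_solution:
  fixes F :: "'a::euclidean_space \<Rightarrow> 'a"
  assumes lip: "L-lipschitz_on UNIV F" and M: "\<And>p. norm (F p) \<le> M"
  obtains x where "x 0 = p" "continuous_on {0..} x"
    "\<And>t. 0 < t \<Longrightarrow> (x has_vector_derivative F (x t)) (at t)"
proof -
  define K where "K = 2 * (L + 1)"
  have L0: "0 \<le> L" using lip by (rule lipschitz_on_nonneg)
  then have K: "0 < K" "L \<le> K / 2" by (auto simp: K_def)
  have M0: "0 \<le> M" using order_trans[OF norm_ge_zero M] .
  define y where "y u t = p + exp (K * t) *\<^sub>R apply_bcontfun u t" for u :: "real \<Rightarrow>\<^sub>C 'a" and t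
  define I where "I u s = integral {0..s} (\<lambda>r. F (y u r))" for u s
  have contF: "continuous_on UNIV F" using lip by (rule lipschitz_on_continuous_on)
  have contFy: "continuous_on A (\<lambda>r. F (y u r))" for u A
    unfolding y_def by (intro continuous_on_compose2[OF contF] continuous_intros) auto
  have I_deriv: "(I u has_vector_derivative F (y u t)) (at t within {0..b})" if "t \<in> {0..b}" for u t b
    unfolding I_def by (rule integral_has_vector_derivative[OF contFy that])
  have I_cont: "continuous_on {0..} (I u)" for u
    unfolding continuous_on_eq_continuous_within
  proof
    fix t :: real assume "t \<in> {0..}"
    then have "continuous (at t within {0..t + 1}) (I u)"
      by (intro has_vector_derivative_continuous[OF I_deriv]) auto
    moreover have "at t within {0..t + 1} = at t within {0..}"
      by (rule at_within_nhd[of _ "{..<t + 1}"]) auto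
    ultimately show "continuous (at t within {0..}) (I u)" by simp
  qed
  have I_bound: "norm (I u s) \<le> M * s" if "0 \<le> s" for u s
  proof -
    have "norm (I u s) \<le> M * (s - 0)"
      unfolding I_def by (rule integral_bound) (use that contFy M in auto)
    then show ?thesis by simp
  qed
  \<comment> \<open>The Picard operator in the weighted variable, continued constantly to negative times.\<close>
  define G where "G u t = exp (- K * max t 0) *\<^sub>R I u (max t 0)" for u t
  have "G u \<in> bcontfun" for u
  proof (rule bcontfun_normI)
    show "continuous_on UNIV (G u)"
      unfolding G_def by (intro continuous_intros continuous_on_compose2[OF I_cont]) auto
    fix t :: real
    define s where "s = max t 0"
    have "0 \<le> s" by (simp add: s_def)
    have "norm (G u t) \<le> exp (- K * s) * (M * s)"
      using I_bound[OF \<open>0 \<le> s\<close>, of u] by (simp add: G_def s_def[symmetric])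
    also have "\<dots> = M * (s * exp (- K * s))" by simp
    also have "s * exp (- K * s) \<le> 1 / K"
    proof -
      have "K * s \<le> exp (K * s)" using exp_ge_add_one_self[of "K * s"] by linarith
      then show ?thesis using K by (simp add: exp_minus field_simps)
    qed
    finally show "norm (G u t) \<le> M * (1 / K)" using M0 by (simp add: mult_left_mono)
  qed
  then have G: "apply_bcontfun (Bcontfun (G u)) = G u" for u by (rule Bcontfun_inverse)
  have contract: "dist (Bcontfun (G u)) (Bcontfun (G v)) \<le> 1 / 2 * dist u v" for u v
  proof (rule dist_bound)
    fix t :: real
    define s where "s = max t 0"
    have "0 \<le> s" by (simp add: s_def)
    have "norm (I u s - I v s) = norm (integral {0..s} (\<lambda>r. F (y u r) - F (y v r)))"
      unfolding I_def by (subst integral_diff) (auto intro!: integrable_continuous_interval contFy)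
    also have "\<dots> \<le> integral {0..s} (\<lambda>r. K / 2 * dist u v * exp (K * r))"
    proof (rule integral_norm_bound_integral)
      fix r
      have "norm (F (y u r) - F (y v r)) \<le> L * norm (y u r - y v r)"
        using lipschitz_on_normD[OF lip] by simp
      also have "y u r - y v r = exp (K * r) *\<^sub>R (apply_bcontfun u r - apply_bcontfun v r)"
        by (simp add: y_def scaleR_diff_right)
      also have "L * norm \<dots> = L * (exp (K * r) * dist (apply_bcontfun u r) (apply_bcontfun v r))"
        by (simp add: dist_norm)
      also have "\<dots> \<le> K / 2 * (exp (K * r) * dist u v)"
        using K L0 dist_bounded[of u r v] by (intro mult_mono) auto
      finally show "norm (F (y u r) - F (y v r)) \<le> K / 2 * dist u v * exp (K * r)"
        by (simp add: mult_ac)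
    qed (intro integrable_continuous_interval continuous_intros contFy)+
    also have "\<dots> = K / 2 * dist u v * ((exp (K * s) - 1) / K)"
      using integral_exp_weight[OF K(1) \<open>0 \<le> s\<close>] by (simp add: integral_unique)
    also have "\<dots> \<le> 1 / 2 * dist u v * exp (K * s)"
      using K by (simp add: field_simps)
    finally have "norm (I u s - I v s) \<le> 1 / 2 * dist u v * exp (K * s)" .
    then have "exp (- K * s) * norm (I u s - I v s) \<le> exp (- K * s) * (1 / 2 * dist u v * exp (K * s))"
      by (intro mult_left_mono) auto
    also have "\<dots> = 1 / 2 * dist u v"
      by (simp add: exp_minus field_simps)
    finally show "dist (apply_bcontfun (Bcontfun (G u)) t) (apply_bcontfun (Bcontfun (G v)) t) \<le> 1 / 2 * dist u v"
      unfolding G by (simp add: G_def s_def[symmetric] dist_norm scaleR_diff_right[symmetric])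
  qed
  obtain u where u: "Bcontfun (G u) = u"
    using banach_fix_type[of "1 / 2" "\<lambda>u. Bcontfun (G u)"] contract by auto
  have y_eq: "y u t = p + I u t" if "0 \<le> t" for t
  proof -
    have "apply_bcontfun u t = exp (- K * t) *\<^sub>R I u t"
      using that G[of u] unfolding u by (simp add: G_def)
    then show ?thesis by (simp add: y_def flip: exp_add)
  qed
  show thesis
  proof (rule that[of "y u"])
    show "y u 0 = p" using y_eq[of 0] by (simp add: I_def)
    show "continuous_on {0..} (y u)"
      unfolding y_def by (intro continuous_intros) auto
    fix t :: real assume "0 < t"
    have "(I u has_vector_derivative F (y u t)) (at t within {0..t + 1})"
      by (rule I_deriv) (use \<open>0 < t\<close> in auto)
    then have "(I u has_vector_derivative F (y u t)) (at t)"
      using \<open>0 < t\<close> at_within_Icc_at[of 0 t "t + 1"] by simp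
    then have *: "((\<lambda>t. p + I u t) has_vector_derivative F (y u t)) (at t)"
      by (auto intro!: derivative_eq_intros)
    show "(y u has_vector_derivative F (y u t)) (at t)"
      by (rule has_vector_derivative_transform_within_open[OF *, of "{0<..}"])
        (use \<open>0 < t\<close> y_eq in auto)
  qed
qed

text \<open>The differential equation is required at interior times only, so that arcs can be cut and joined
without looking at derivatives at the joints.\<close>

definition integral_curve :: "('a::real_normed_vector \<Rightarrow> 'a) \<Rightarrow> (real \<Rightarrow> 'a) \<Rightarrow> real \<Rightarrow> bool" where
  "integral_curve f x T \<longleftrightarrow> 0 < T \<and> continuous_on {0..T} x \<and>
     (\<forall>t\<in>{0<..<T}. (x has_vector_derivative f (x t)) (at t))"

lemma integral_curve_continuous: "integral_curve f x T \<Longrightarrow> continuous_on {0..T} x"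
  by (simp add: integral_curve_def)

lemma integral_curve_reverse:
  assumes x: "integral_curve (\<lambda>p. - f p) x T"
  shows "integral_curve f (\<lambda>t. x (T - t)) T"
  unfolding integral_curve_def
proof (intro conjI ballI)
  show "0 < T" using x unfolding integral_curve_def by blast
  show "continuous_on {0..T} (\<lambda>t. x (T - t))"
    by (rule continuous_on_compose2[OF integral_curve_continuous[OF x]]) (auto intro!: continuous_intros)
  fix t assume "t \<in> {0<..<T}"
  then have "(x has_vector_derivative - f (x (T - t))) (at (T - t))"
    using x unfolding integral_curve_def by auto
  moreover have "((\<lambda>t. T - t) has_vector_derivative - 1) (at t)"
    by (auto intro!: derivative_eq_intros)
  ultimately have "((x \<circ> (\<lambda>t. T - t)) has_vector_derivative (- 1) *\<^sub>R (- f (x (T - t)))) (at t)"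
    by (intro vector_diff_chain_at)
  then show "((\<lambda>t. x (T - t)) has_vector_derivative f (x (T - t))) (at t)" by (simp add: o_def)
qed

lemma integral_curve_speed:
  fixes f :: "'a::real_inner \<Rightarrow> 'a"
  assumes x: "integral_curve f x T" and "0 \<le> s" "s \<le> t" "t \<le> T"
    and c: "\<And>r. r \<in> {s<..<t} \<Longrightarrow> c \<le> f (x r) \<bullet> w"
  shows "x s \<bullet> w + c * (t - s) \<le> x t \<bullet> w"
proof (cases "s = t")
  case False
  then have "s < t" using assms by simp
  have "continuous_on {s..t} (\<lambda>r. x r \<bullet> w)"
    using integral_curve_continuous[OF x] assms
    by (auto intro!: continuous_intros elim: continuous_on_subset)
  moreover have "((\<lambda>r. x r \<bullet> w) has_derivative (\<lambda>h. h * (f (x r) \<bullet> w))) (at r)" if "s < r" "r < t" for r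
  proof -
    have "(x has_vector_derivative f (x r)) (at r)"
      using x assms that unfolding integral_curve_def by auto
    then show ?thesis
      unfolding has_vector_derivative_def by (auto intro!: derivative_eq_intros)
  qed
  ultimately obtain r where r: "s < r" "r < t" "x t \<bullet> w - x s \<bullet> w = (t - s) * (f (x r) \<bullet> w)"
    using mvt[OF \<open>s < t\<close>, of "\<lambda>r. x r \<bullet> w" "\<lambda>r h. h * (f (x r) \<bullet> w)"] by blast
  then show ?thesis
    using c[of r] mult_left_mono[of c "f (x r) \<bullet> w" "t - s"] \<open>s < t\<close> by (simp add: algebra_simps)
qed simp

lemma integral_curve_lipschitz:
  assumes x: "integral_curve f x T" and st: "0 \<le> s" "s \<le> t" "t \<le> T"
    and M: "\<And>r. r \<in> {s<..<t} \<Longrightarrow> norm (f (x r)) \<le> M"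
  shows "dist (x s) (x t) \<le> M * (t - s)"
proof (cases "s = t")
  case False
  then have "s < t" using st by simp
  have "norm (x t - x s) \<le> M * t - M * s"
  proof (rule differentiable_bound_general[OF \<open>s < t\<close>])
    show "continuous_on {s..t} x"
      by (rule continuous_on_subset[OF integral_curve_continuous[OF x]]) (use st in auto)
    show "(x has_vector_derivative f (x r)) (at r)" if "s < r" "r < t" for r
      using x st that unfolding integral_curve_def by auto
    show "((*) M has_vector_derivative M) (at r)" for r
      by (auto intro!: derivative_eq_intros simp flip: has_real_derivative_iff_has_vector_derivative)
  qed (use M in \<open>auto intro!: continuous_intros\<close>)
  then show ?thesis by (simp add: dist_norm norm_minus_commute right_diff_distrib)
qed simp

text \<open>Over a time \<open>T\<close> with \<open>L T \<le> 1/2\<close> the maximal distance \<open>m\<close> of two curves is at most the initial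
distance plus \<open>m / 2\<close>.\<close>

lemma integral_curves_dependence:
  assumes x: "integral_curve f x T" and y: "integral_curve f y T"
    and C: "x ` {0..T} \<subseteq> C" "y ` {0..T} \<subseteq> C" and lip: "L-lipschitz_on C f"
    and small: "L * T \<le> 1 / 2"
  shows "dist (x T) (y T) \<le> 2 * dist (x 0) (y 0)"
proof -
  have T: "0 < T" using x unfolding integral_curve_def by blast
  have L0: "0 \<le> L" using lip by (rule lipschitz_on_nonneg)
  have cont: "continuous_on {0..T} (\<lambda>t. x t - y t)"
    by (intro continuous_intros integral_curve_continuous[OF x] integral_curve_continuous[OF y])
  then have "continuous_on {0..T} (\<lambda>t. norm (x t - y t))"
    by (rule continuous_on_norm)
  then obtain s where s: "s \<in> {0..T}" "\<And>t. t \<in> {0..T} \<Longrightarrow> norm (x t - y t) \<le> norm (x s - y s)"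
    using continuous_attains_sup[of "{0..T}" "\<lambda>t. norm (x t - y t)"] T by auto
  let ?m = "norm (x s - y s)"
  have "norm ((x s - y s) - (x 0 - y 0)) \<le> L * ?m * s - L * ?m * 0"
  proof (cases "s = 0")
    case False
    then have "0 < s" using s by auto
    show ?thesis
    proof (rule differentiable_bound_general[OF \<open>0 < s\<close>])
      show "continuous_on {0..s} (\<lambda>t. x t - y t)"
        by (rule continuous_on_subset[OF cont]) (use s in auto)
      fix t assume "0 < t" "t < s"
      then have t: "t \<in> {0<..<T}" using s by auto
      then show "((\<lambda>t. x t - y t) has_vector_derivative f (x t) - f (y t)) (at t)"
        using x y unfolding integral_curve_def by (intro has_vector_derivative_diff) auto
      show "((\<lambda>t. L * ?m * t) has_vector_derivative L * ?m) (at t)"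
        by (auto intro!: derivative_eq_intros simp flip: has_real_derivative_iff_has_vector_derivative)
      have "norm (f (x t) - f (y t)) \<le> L * norm (x t - y t)"
        using t C by (intro lipschitz_on_normD[OF lip]) auto
      also have "\<dots> \<le> L * ?m" using s(2)[of t] t L0 by (intro mult_left_mono) auto
      finally show "norm (f (x t) - f (y t)) \<le> L * ?m" .
    qed (intro continuous_intros)
  qed simp
  also have "\<dots> \<le> ?m * (L * T)"
    using s(1) L0 by (simp add: mult_ac mult_left_mono mult_right_mono)
  also have "\<dots> \<le> ?m * (1 / 2)" using small by (intro mult_left_mono) auto
  finally have "?m \<le> norm (x 0 - y 0) + ?m / 2"
    using norm_triangle_ineq2[of "x s - y s" "x 0 - y 0"] by linarith
  then show ?thesis using s(2)[of T] T by (simp add: dist_norm)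
qed

text \<open>Retracting onto a compact convex set turns a field that is Lipschitz there into a bounded, globally
Lipschitz one, to which the global existence result applies.\<close>

lemma closest_point_extension:
  fixes f :: "'a::euclidean_space \<Rightarrow> 'a"
  assumes C: "compact C" "convex C" "C \<noteq> {}" and lip: "L-lipschitz_on C f"
  obtains M where "\<And>p. norm (f (closest_point C p)) \<le> M" "L-lipschitz_on UNIV (\<lambda>p. f (closest_point C p))"
proof -
  have cl: "closed C" using C(1) by (rule compact_imp_closed)
  have "compact (f ` C)"
    using lipschitz_on_continuous_on[OF lip] C(1) by (rule compact_continuous_image)
  then obtain M where M: "\<forall>q\<in>f ` C. norm q \<le> M"
    using compact_imp_bounded bounded_iff by metis
  have "1-lipschitz_on UNIV (closest_point C)"
    using closest_point_lipschitz[OF C(2) cl C(3)] by (intro lipschitz_onI) auto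
  then have "(L * 1)-lipschitz_on UNIV (\<lambda>p. f (closest_point C p))"
    by (rule lipschitz_on_compose2)
      (use lip closest_point_in_set[OF cl C(3)] in \<open>auto elim!: lipschitz_on_subset\<close>)
  then show thesis using M closest_point_in_set[OF cl C(3)] by (intro that[of M]) auto
qed

text \<open>Along the curve the component in direction \<open>w\<close> grows at rate at least \<open>\<kappa>\<close>, whereas it is bounded
on \<open>C\<close>. So the curve leaves \<open>G\<close>, and it does so through the frontier.\<close>

lemma exits_through_frontier:
  fixes f :: "'a::euclidean_space \<Rightarrow> 'a"
  assumes C: "compact C" "convex C" and lip: "L-lipschitz_on C f"
    and speed: "0 < \<kappa>" "\<And>q. q \<in> C \<Longrightarrow> \<kappa> \<le> f q \<bullet> w"
    and G: "open G" "G \<subseteq> C" "p \<in> G"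
  obtains z T where "integral_curve f z T" "z 0 = p" "z T \<in> frontier G" "z ` {0..T} \<subseteq> closure G"
proof -
  have C': "closed C" "C \<noteq> {}" using C(1) G by (auto intro: compact_imp_closed)
  let ?F = "\<lambda>q. f (closest_point C q)"
  obtain M where "\<And>q. norm (?F q) \<le> M" "L-lipschitz_on UNIV ?F"
    using closest_point_extension[OF C C'(2) lip] by blast
  then obtain x where x: "x 0 = p" "continuous_on {0..} x"
     "\<And>t. 0 < t \<Longrightarrow> (x has_vector_derivative ?F (x t)) (at t)"
    using global_forward_solution[of L ?F M p] by blast
  have curve: "integral_curve ?F x T" if "0 < T" for T
    using x that unfolding integral_curve_def by (auto elim!: continuous_on_subset)
  have "compact ((\<lambda>q. q \<bullet> w) ` C)"
    by (intro compact_continuous_image continuous_intros C)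
  then obtain B where B: "\<And>q. q \<in> C \<Longrightarrow> \<bar>q \<bullet> w\<bar> \<le> B"
    using compact_imp_bounded bounded_iff by (metis image_eqI real_norm_def)
  \<comment> \<open>If the curve were still in \<open>C\<close> at time \<open>U\<close>, its height would exceed the bound \<open>B\<close> by \<open>1\<close>.\<close>
  define U where "U = (B + 1 - p \<bullet> w) / \<kappa>"
  have U: "0 < U" unfolding U_def using B[of p] G speed(1) by (intro divide_pos_pos) auto
  have "x 0 \<bullet> w + \<kappa> * (U - 0) \<le> x U \<bullet> w"
    by (rule integral_curve_speed[OF curve[OF U]]) (use U speed(2) closest_point_in_set[OF C'] in auto)
  then have "B + 1 \<le> x U \<bullet> w" using x(1) speed(1) by (simp add: U_def)
  then have "x U \<in> - G" using B[of "x U"] G(2) by fastforce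
  moreover have "continuous_on {0..U} x" using x(2) by (rule continuous_on_subset) auto
  ultimately obtain T where T: "T \<in> {0..U}" "x T \<in> - G" "\<And>s. s \<in> {0..<T} \<Longrightarrow> x s \<notin> - G"
    using first_hit[of 0 U x "- G"] U G(1) by (metis closed_Compl less_imp_le)
  have "T \<noteq> 0" using T(2) x(1) G(3) by auto
  then have "0 < T" using T(1) by auto
  have "x ` closure {0..<T} \<subseteq> closure G"
  proof (rule image_closure_subset)
    show "continuous_on (closure {0..<T}) x"
      by (rule continuous_on_subset[OF x(2)]) (use \<open>0 < T\<close> in auto)
    show "x ` {0..<T} \<subseteq> closure G" using T(3) closure_subset by fastforce
  qed simp
  then have img: "x ` {0..T} \<subseteq> closure G" using \<open>0 < T\<close> by simp
  have "closure G \<subseteq> C" using G(2) C'(1) by (rule closure_minimal)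
  then have "integral_curve f x T"
    using curve[OF \<open>0 < T\<close>] img unfolding integral_curve_def
    by (auto simp: image_subset_iff closest_point_self subset_iff)
  moreover have "x T \<in> frontier G"
    using T(2) img \<open>0 < T\<close> G(1) by (auto simp: frontier_def interior_open)
  ultimately show thesis using that x(1) img by blast
qed

text \<open>The new time is \<open>\<Theta> s\<close>, the integral of \<open>c\<close> up to \<open>s\<close>; the curve is reparametrized by the
inverse of \<open>\<Theta>\<close>.\<close>

lemma integral_curve_time_change:
  fixes f g :: "'a::real_normed_vector \<Rightarrow> 'a"
  assumes x: "integral_curve g x T"
    and g: "\<And>s. s \<in> {0..T} \<Longrightarrow> g (x s) = c s *\<^sub>R f (x s)"
    and c: "continuous_on {0..T} c" "\<And>s. s \<in> {0..T} \<Longrightarrow> 0 < c s"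
  obtains z U where "integral_curve f z U" "z 0 = x 0" "z U = x T" "z ` {0..U} \<subseteq> x ` {0..T}"
proof -
  have T: "0 < T" using x unfolding integral_curve_def by blast
  define \<Theta> where "\<Theta> s = integral {0..s} c" for s
  have \<Theta>': "(\<Theta> has_vector_derivative c s) (at s within {0..T})" if "s \<in> {0..T}" for s
    unfolding \<Theta>_def by (rule integral_has_vector_derivative[OF c(1) that])
  have \<Theta>_deriv: "(\<Theta> has_real_derivative c s) (at s)" if "s \<in> {0<..<T}" for s
    using \<Theta>'[of s] that at_within_Icc_at[of 0 s T]
    by (simp add: has_real_derivative_iff_has_vector_derivative)
  have \<Theta>_cont: "continuous_on {0..T} \<Theta>"
    using \<Theta>' has_vector_derivative_continuous by (metis continuous_on_eq_continuous_within)
  have \<Theta>_less: "\<Theta> s < \<Theta> t" if "0 \<le> s" "s < t" "t \<le> T" for s t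
  proof (rule DERIV_pos_imp_increasing_open[OF \<open>s < t\<close>])
    show "\<exists>y. (\<Theta> has_real_derivative y) (at r) \<and> 0 < y" if "s < r" "r < t" for r
      using \<Theta>_deriv[of r] c(2)[of r] that \<open>0 \<le> s\<close> \<open>t \<le> T\<close> by (intro exI[of _ "c r"]) auto
    show "continuous_on {s..t} \<Theta>"
      by (rule continuous_on_subset[OF \<Theta>_cont]) (use that in auto)
  qed
  have inj: "inj_on \<Theta> {0..T}"
    by (rule linorder_inj_onI) (use \<Theta>_less in force)+
  define U where "U = \<Theta> T"
  have \<Theta>0: "\<Theta> 0 = 0" by (simp add: \<Theta>_def)
  have "0 < U" using \<Theta>_less[of 0 T] T by (simp add: U_def \<Theta>0)
  have img: "\<Theta> ` {0..T} = {0..U}"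
  proof (intro equalityI subsetI)
    fix u assume "u \<in> \<Theta> ` {0..T}"
    then obtain s where s: "s \<in> {0..T}" "u = \<Theta> s" by blast
    then show "u \<in> {0..U}"
      using \<Theta>_less[of 0 s] \<Theta>_less[of s T] \<Theta>0 by (cases "s = 0"; cases "s = T") (auto simp: U_def)
  next
    fix u assume "u \<in> {0..U}"
    then show "u \<in> \<Theta> ` {0..T}"
      using IVT'[of \<Theta> 0 u T] \<Theta>_cont T \<Theta>0 by (auto simp: U_def)
  qed
  define \<theta> where "\<theta> = inv_into {0..T} \<Theta>"
  have \<theta>\<Theta>: "\<theta> (\<Theta> s) = s" if "s \<in> {0..T}" for s
    unfolding \<theta>_def using inj that by simp
  have \<theta>_in: "\<theta> u \<in> {0..T}" and \<Theta>\<theta>: "\<Theta> (\<theta> u) = u" if "u \<in> {0..U}" for u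
    unfolding \<theta>_def using that img by (auto intro: f_inv_into_f inv_into_into simp del: atLeastAtMost_iff)
  have \<theta>_cont: "continuous_on {0..U} \<theta>"
    using continuous_on_inv[OF \<Theta>_cont, of \<theta>] \<theta>\<Theta> img by simp
  have "integral_curve f (x \<circ> \<theta>) U"
    unfolding integral_curve_def
  proof (intro conjI ballI)
    show "continuous_on {0..U} (x \<circ> \<theta>)"
      by (intro continuous_on_compose \<theta>_cont continuous_on_subset[OF integral_curve_continuous[OF x]])
        (use \<theta>_in in auto)
    fix u assume u: "u \<in> {0<..<U}"
    then have uU: "u \<in> {0..U}" by simp
    have "\<theta> u \<noteq> 0" "\<theta> u \<noteq> T" using \<Theta>\<theta>[OF uU] u \<Theta>0 by (auto simp: U_def)
    then have \<theta>u: "\<theta> u \<in> {0<..<T}" using \<theta>_in[OF uU] by auto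
    have pos: "c (\<theta> u) \<noteq> 0" using c(2)[OF \<theta>_in[OF uU]] by simp
    have "(\<theta> has_real_derivative inverse (c (\<theta> u))) (at u)"
    proof (rule DERIV_inverse_function[where f = \<Theta> and a = 0 and b = U])
      show "(\<Theta> has_real_derivative c (\<theta> u)) (at (\<theta> u))" by (rule \<Theta>_deriv[OF \<theta>u])
      show "isCont \<theta> u"
        by (rule continuous_on_interior[OF \<theta>_cont]) (use u in simp)
    qed (use u pos \<Theta>\<theta> in auto)
    then have d: "(\<theta> has_vector_derivative inverse (c (\<theta> u))) (at u)"
      by (simp add: has_real_derivative_iff_has_vector_derivative)
    have "(x has_vector_derivative c (\<theta> u) *\<^sub>R f (x (\<theta> u))) (at (\<theta> u))"
      using x \<theta>u g[OF \<theta>_in[OF uU]] unfolding integral_curve_def by metis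
    from vector_diff_chain_at[OF d this] pos
    show "((x \<circ> \<theta>) has_vector_derivative f ((x \<circ> \<theta>) u)) (at u)" by simp
  qed fact
  moreover have "(x \<circ> \<theta>) 0 = x 0" "(x \<circ> \<theta>) U = x T"
    using \<theta>\<Theta>[of 0] \<theta>\<Theta>[of T] \<Theta>0 T by (simp_all add: U_def)
  moreover have "(x \<circ> \<theta>) ` {0..U} \<subseteq> x ` {0..T}" using \<theta>_in by auto
  ultimately show thesis by (rule that)
qed

section \<open>A closed curve made of two arcs\<close>

lemma lipschitz_on_normalized:
  fixes f :: "'a::euclidean_space \<Rightarrow> 'b::euclidean_space"
  assumes "compact C" and lip: "L-lipschitz_on C f"
    and c: "0 < c" "\<And>p. p \<in> C \<Longrightarrow> c \<le> \<bar>f p \<bullet> w\<bar>"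
  obtains K where "K-lipschitz_on C (\<lambda>p. (1 / (f p \<bullet> w)) *\<^sub>R f p)"
proof -
  have "compact (f ` C)"
    using lipschitz_on_continuous_on[OF lip] \<open>compact C\<close> by (rule compact_continuous_image)
  then obtain B where B: "0 < B" "\<And>p. p \<in> C \<Longrightarrow> norm (f p) \<le> B"
    using compact_imp_bounded bounded_pos by (metis imageI)
  have L0: "0 \<le> L" using lip by (rule lipschitz_on_nonneg)
  define K where "K = L / c + L * norm w * B / (c * c)"
  have "K-lipschitz_on C (\<lambda>p. (1 / (f p \<bullet> w)) *\<^sub>R f p)"
  proof (rule lipschitz_onI)
    show "0 \<le> K" using L0 c(1) B(1) by (simp add: K_def)
    fix p q assume pq: "p \<in> C" "q \<in> C"
    define a b where "a = f p \<bullet> w" and "b = f q \<bullet> w"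
    have ab: "c \<le> \<bar>a\<bar>" "c \<le> \<bar>b\<bar>" using c(2) pq by (auto simp: a_def b_def)
    then have nz: "a \<noteq> 0" "b \<noteq> 0" using c(1) by auto
    have d: "norm (f p - f q) \<le> L * dist p q"
      using lipschitz_onD[OF lip pq] by (simp add: dist_norm)
    have "\<bar>b - a\<bar> = \<bar>(f q - f p) \<bullet> w\<bar>" by (simp add: a_def b_def inner_diff_left)
    also have "\<dots> \<le> norm (f q - f p) * norm w" by (rule Cauchy_Schwarz_ineq2)
    also have "\<dots> \<le> L * dist p q * norm w"
      using d by (intro mult_right_mono) (simp_all add: norm_minus_commute)
    finally have e: "\<bar>b - a\<bar> \<le> L * dist p q * norm w" .
    have "(1 / a) *\<^sub>R f p - (1 / b) *\<^sub>R f q = (1 / a) *\<^sub>R (f p - f q) + ((b - a) / (a * b)) *\<^sub>R f q"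
      using nz by (simp add: algebra_simps diff_divide_distrib)
    then have "norm ((1 / a) *\<^sub>R f p - (1 / b) *\<^sub>R f q) \<le>
        norm ((1 / a) *\<^sub>R (f p - f q)) + norm (((b - a) / (a * b)) *\<^sub>R f q)"
      using norm_triangle_ineq by metis
    also have "\<dots> = norm (f p - f q) / \<bar>a\<bar> + \<bar>b - a\<bar> * norm (f q) / (\<bar>a\<bar> * \<bar>b\<bar>)"
      by (simp add: abs_mult)
    also have "\<dots> \<le> L * dist p q / c + (L * dist p q * norm w) * B / (c * c)"
      using ab c(1) d e B pq L0 by (intro add_mono frac_le mult_mono) auto
    also have "\<dots> = K * dist p q" by (simp add: K_def algebra_simps add_divide_distrib)
    finally show "dist ((1 / (f p \<bullet> w)) *\<^sub>R f p) ((1 / (f q \<bullet> w)) *\<^sub>R f q) \<le> K * dist p q"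
      by (simp add: dist_norm a_def b_def)
  qed
  then show thesis by (rule that)
qed

text \<open>For \<open>q\<close> on the segment from \<open>p1\<close> to \<open>p2\<close>, follow both fields from \<open>q\<close> for a time \<open>h\<close>. Both end points
have height \<open>q \<bullet> w + h\<close>, so they agree as soon as their gap in direction \<open>n\<close> vanishes. For small
\<open>h\<close> the gap has the sign of \<open>(F2 q - F1 q) \<bullet> n\<close> at both ends of the segment, and these signs
differ; the intermediate value theorem yields \<open>q\<close>. By \<open>span\<close>, a vector is determined by its
components along \<open>w\<close> and \<open>n\<close>.\<close>

lemma normalized_curves_meet:
  fixes F1 F2 :: "'a::euclidean_space \<Rightarrow> 'a"
  assumes lip: "L-lipschitz_on (cball p r) F1" "L-lipschitz_on (cball p r) F2"
    and unit: "\<And>q. q \<in> cball p r \<Longrightarrow> F1 q \<bullet> w = 1" "\<And>q. q \<in> cball p r \<Longrightarrow> F2 q \<bullet> w = 1"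
    and span: "\<And>v. v \<bullet> w = 0 \<Longrightarrow> v \<bullet> n = 0 \<Longrightarrow> v = 0"
    and ends: "p1 \<in> ball p r" "0 < (F2 p1 - F1 p1) \<bullet> n" "p2 \<in> ball p r" "(F2 p2 - F1 p2) \<bullet> n < 0"
  obtains h x y where "integral_curve F1 x h" "integral_curve F2 y h" "x 0 = y 0" "x h = y h"
    "x ` {0..h} \<subseteq> cball p r" "y ` {0..h} \<subseteq> cball p r"
proof -
  let ?C = "cball p r"
  have "p1 \<in> ?C" using ends(1) ball_subset_cball by blast
  then have C: "compact ?C" "convex ?C" "?C \<noteq> {}" by (blast intro: compact_cball convex_cball)+
  let ?G1 = "\<lambda>q. F1 (closest_point ?C q)" and ?G2 = "\<lambda>q. F2 (closest_point ?C q)"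
  obtain M1 where M1: "\<And>q. norm (?G1 q) \<le> M1" and G1: "L-lipschitz_on UNIV ?G1"
    using closest_point_extension[OF C lip(1)] by blast
  obtain M2 where M2: "\<And>q. norm (?G2 q) \<le> M2" and G2: "L-lipschitz_on UNIV ?G2"
    using closest_point_extension[OF C lip(2)] by blast
  have L0: "0 \<le> L" using lip(1) by (rule lipschitz_on_nonneg)
  define M where "M = max M1 M2 + 1"
  have M: "0 < M" "\<And>q. norm (?G1 q) \<le> M" "\<And>q. norm (?G2 q) \<le> M"
    using M1 M2 order_trans[OF norm_ge_zero M1] unfolding M_def
    by (auto intro: order_trans simp: add_nonneg_pos le_max_iff_disj add_increasing2)
  \<comment> \<open>Within distance \<open>\<rho>\<close> of \<open>p1\<close> and \<open>p2\<close> the two fields together vary by less than their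
    difference in direction \<open>n\<close>, and the balls of radius \<open>\<rho>\<close> about the segment stay in the cball.\<close>
  obtain \<rho> where \<rho>: "0 < \<rho>" "dist p p1 \<le> r - \<rho>" "dist p p2 \<le> r - \<rho>"
    "2 * L * norm n * \<rho> < (F2 p1 - F1 p1) \<bullet> n" "2 * L * norm n * \<rho> < (F1 p2 - F2 p2) \<bullet> n"
  proof -
    define e where "e = min ((F2 p1 - F1 p1) \<bullet> n) ((F1 p2 - F2 p2) \<bullet> n)"
    have e: "0 < e" using ends by (simp add: e_def inner_diff_left)
    define d where "d = 2 * L * norm n + 1"
    have d: "0 < d" unfolding d_def using L0 by (intro add_nonneg_pos) auto
    define \<rho> where "\<rho> = min (e / d) (min (r - dist p p1) (r - dist p p2))"
    have pos: "0 < \<rho>" using e d ends by (simp add: \<rho>_def)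
    have "\<rho> * d \<le> e / d * d"
      using d by (intro mult_right_mono) (auto simp: \<rho>_def)
    then have "\<rho> * d \<le> e" using d by simp
    moreover have "\<rho> * d = 2 * L * norm n * \<rho> + \<rho>" by (simp add: d_def algebra_simps)
    ultimately have "2 * L * norm n * \<rho> < e" using pos by linarith
    moreover have "e \<le> (F2 p1 - F1 p1) \<bullet> n" "e \<le> (F1 p2 - F2 p2) \<bullet> n" by (simp_all add: e_def)
    ultimately have "2 * L * norm n * \<rho> < (F2 p1 - F1 p1) \<bullet> n"
        "2 * L * norm n * \<rho> < (F1 p2 - F2 p2) \<bullet> n" by linarith+
    moreover have "dist p p1 \<le> r - \<rho>" "dist p p2 \<le> r - \<rho>" by (auto simp: \<rho>_def)
    ultimately show thesis using pos by (intro that[of \<rho>])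
  qed
  \<comment> \<open>Curves travel at most \<open>\<rho>\<close> in time \<open>h\<close> and depend continuously on their starting points.\<close>
  define h where "h = min (\<rho> / M) (1 / (2 * (L + 1)))"
  have h: "0 < h" "M * h \<le> \<rho>" "L * h \<le> 1 / 2"
  proof -
    show "0 < h" using \<rho>(1) M(1) L0 by (simp add: h_def)
    have "M * h \<le> M * (\<rho> / M)" using M(1) by (intro mult_left_mono) (auto simp: h_def)
    then show "M * h \<le> \<rho>" using M(1) by simp
    have "L * h \<le> L * (1 / (2 * (L + 1)))" using L0 by (intro mult_left_mono) (auto simp: h_def)
    also have "\<dots> \<le> 1 / 2" using L0 by (simp add: field_simps)
    finally show "L * h \<le> 1 / 2" .
  qed
  have sol: "\<exists>x. x 0 = q \<and> integral_curve G x h" if G: "L-lipschitz_on UNIV G" "\<And>q. norm (G q) \<le> M"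
    for q and G :: "'a \<Rightarrow> 'a"
  proof -
    obtain x where "x 0 = q" "continuous_on {0..} x"
       "\<And>t. 0 < t \<Longrightarrow> (x has_vector_derivative G (x t)) (at t)"
      using global_forward_solution[OF G, of q] by blast
    then show ?thesis using h(1) unfolding integral_curve_def
      by (intro exI[of _ x]) (auto elim!: continuous_on_subset)
  qed
  obtain X where X: "\<And>q. X q 0 = q" "\<And>q. integral_curve ?G1 (X q) h"
    using sol[OF G1 M(2)] by metis
  obtain Y where Y: "\<And>q. Y q 0 = q" "\<And>q. integral_curve ?G2 (Y q) h"
    using sol[OF G2 M(3)] by metis
  have near: "dist q (Z t) \<le> \<rho>" if "integral_curve G Z h" "Z 0 = q" "\<And>q. norm (G q) \<le> M" "t \<in> {0..h}"
    for G Z q t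
  proof -
    have "dist (Z 0) (Z t) \<le> M * (t - 0)"
      by (rule integral_curve_lipschitz[OF that(1)]) (use that in auto)
    also have "\<dots> \<le> M * h" using that M(1) by (intro mult_left_mono) auto
    finally show ?thesis using h(2) that(2) by simp
  qed
  define \<phi> where "\<phi> q = (Y q h - X q h) \<bullet> n" for q
  have \<phi>_cont: "continuous_on UNIV \<phi>"
  proof -
    have "2-lipschitz_on UNIV (\<lambda>q. Z q h)"
      if "\<And>q. Z q 0 = q" "\<And>q. integral_curve G (Z q) h" "L-lipschitz_on UNIV G" for Z and G :: "'a \<Rightarrow> 'a"
    proof (rule lipschitz_onI)
      show "dist (Z q h) (Z q' h) \<le> 2 * dist q q'" for q q'
        using integral_curves_dependence[OF that(2)[of q] that(2)[of q'] _ _ that(3) h(3)] that(1) by simp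
    qed simp
    from this[OF X G1] this[OF Y G2] show ?thesis
      unfolding \<phi>_def by (intro continuous_intros) (blast intro: lipschitz_on_continuous_on)+
  qed
  \<comment> \<open>Near each end point the difference of the fields keeps its sign, and so does the gap.\<close>
  have gap: "0 < (Y q h - X q h) \<bullet> m"
    if q: "dist p q \<le> r - \<rho>" and m: "norm m = norm n" "2 * L * norm n * \<rho> < (F2 q - F1 q) \<bullet> m" for q m
  proof -
    have qC: "closest_point ?C q = q" using q \<rho>(1) by (intro closest_point_self) auto
    have bound: "G q \<bullet> m' - L * norm n * \<rho> \<le> G (Z t) \<bullet> m'"
      if "integral_curve G Z h" "Z 0 = q" "\<And>q. norm (G q) \<le> M" "L-lipschitz_on UNIV G" "t \<in> {0<..<h}"
        "norm m' = norm n" for G Z t m'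
    proof -
      have "(G q - G (Z t)) \<bullet> m' \<le> norm (G q - G (Z t)) * norm m'" by (rule norm_cauchy_schwarz)
      also have "\<dots> \<le> (L * \<rho>) * norm m'"
      proof (rule mult_right_mono)
        have "norm (G q - G (Z t)) \<le> L * dist q (Z t)"
          using lipschitz_onD[OF that(4)] by (simp add: dist_norm)
        also have "\<dots> \<le> L * \<rho>"
          using near[OF that(1-3), of t] that(5) L0 by (intro mult_left_mono) auto
        finally show "norm (G q - G (Z t)) \<le> L * \<rho>" .
      qed simp
      finally show ?thesis using that(6) by (simp add: inner_diff_left mult_ac)
    qed
    have "Y q 0 \<bullet> m + (?G2 q \<bullet> m - L * norm n * \<rho>) * (h - 0) \<le> Y q h \<bullet> m"
      by (rule integral_curve_speed[OF Y(2)])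
        (use h(1) m in \<open>auto intro!: bound[OF Y(2) Y(1) M(3) G2]\<close>)
    moreover have "X q 0 \<bullet> (- m) + (?G1 q \<bullet> (- m) - L * norm n * \<rho>) * (h - 0) \<le> X q h \<bullet> (- m)"
      by (rule integral_curve_speed[OF X(2)])
        (use h(1) m in \<open>auto intro!: bound[OF X(2) X(1) M(2) G1, of _ "- m", simplified]\<close>)
    moreover have "0 < ((F2 q - F1 q) \<bullet> m - 2 * L * norm n * \<rho>) * h"
      using m(2) h(1) by simp
    ultimately show ?thesis using X(1) Y(1) qC by (simp add: inner_diff_left algebra_simps)
  qed
  have "0 < \<phi> p1" unfolding \<phi>_def by (rule gap) (use \<rho> in auto)
  moreover have "\<phi> p2 < 0"
    using gap[of p2 "- n"] \<rho> by (simp add: \<phi>_def inner_diff_left)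
  moreover have "connected (\<phi> ` closed_segment p1 p2)"
    using continuous_on_subset[OF \<phi>_cont] by (intro connected_continuous_image) auto
  ultimately have "0 \<in> \<phi> ` closed_segment p1 p2"
    using connectedD_interval[of "\<phi> ` closed_segment p1 p2" "\<phi> p2" "\<phi> p1" 0]
    by (simp add: less_imp_le)
  then obtain q where q: "q \<in> closed_segment p1 p2" "\<phi> q = 0" by auto
  have "closed_segment p1 p2 \<subseteq> cball p (r - \<rho>)"
    using \<rho>(2,3) by (intro closed_segment_subset convex_cball) auto
  then have qr: "dist p q \<le> r - \<rho>" using q(1) by auto
  have inC: "Z ` {0..h} \<subseteq> ?C" if "integral_curve G Z h" "Z 0 = q" "\<And>q. norm (G q) \<le> M" for G Z
  proof
    fix v assume "v \<in> Z ` {0..h}"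
    then have "dist q v \<le> \<rho>" using near[OF that] by auto
    then show "v \<in> ?C" using qr dist_triangle[of p v q] by auto
  qed
  have XC: "X q ` {0..h} \<subseteq> ?C" by (rule inC[OF X(2) X(1) M(2)])
  have YC: "Y q ` {0..h} \<subseteq> ?C" by (rule inC[OF Y(2) Y(1) M(3)])
  have X1: "integral_curve F1 (X q) h" and Y1: "integral_curve F2 (Y q) h"
    using X(2)[of q] Y(2)[of q] XC YC unfolding integral_curve_def
    by (auto simp: image_subset_iff closest_point_self)
  have height: "Z h \<bullet> w = q \<bullet> w + h"
    if "integral_curve F Z h" "Z 0 = q" "Z ` {0..h} \<subseteq> ?C" "\<And>v. v \<in> ?C \<Longrightarrow> F v \<bullet> w = 1" for F Z
  proof -
    have "Z t \<in> ?C" if "t \<in> {0..h}" for t using \<open>Z ` {0..h} \<subseteq> ?C\<close> that by blast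
    then have "Z 0 \<bullet> w + 1 * (h - 0) \<le> Z h \<bullet> w" "Z 0 \<bullet> (- w) + (- 1) * (h - 0) \<le> Z h \<bullet> (- w)"
      using h(1) that(4) by (intro integral_curve_speed[OF that(1)]; simp)+
    then show ?thesis using that(2) by simp
  qed
  have "Y q h = X q h"
    using span[of "Y q h - X q h"] q(2) height[OF X1 X(1) XC unit(1)] height[OF Y1 Y(1) YC unit(2)]
    by (simp add: \<phi>_def inner_diff_left)
  then show thesis using that[OF X1 Y1 _ _ XC YC] X(1) Y(1) by simp
qed

text \<open>The two products compare the slopes \<open>(f \<bullet> n) / (f \<bullet> w)\<close> of the fields with cleared denominators;
the inequality changes direction because the product of the denominators is negative. Dividing
\<open>f1\<close> by the negative number \<open>f1 \<bullet> w\<close> reverses it, so that two arcs with common ends become a closed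
curve that is traversed in one direction.\<close>

lemma two_field_loop:
  fixes f1 f2 :: "'a::euclidean_space \<Rightarrow> 'a"
  assumes lip: "L1-lipschitz_on (cball p r) f1" "L2-lipschitz_on (cball p r) f2"
    and c: "0 < c" "\<And>q. q \<in> cball p r \<Longrightarrow> f1 q \<bullet> w \<le> - c" "\<And>q. q \<in> cball p r \<Longrightarrow> c \<le> f2 q \<bullet> w"
    and span: "\<And>v. v \<bullet> w = 0 \<Longrightarrow> v \<bullet> n = 0 \<Longrightarrow> v = 0"
    and p1: "p1 \<in> ball p r" "(f2 p1 \<bullet> n) * (f1 p1 \<bullet> w) < (f1 p1 \<bullet> n) * (f2 p1 \<bullet> w)"
    and p2: "p2 \<in> ball p r" "(f1 p2 \<bullet> n) * (f2 p2 \<bullet> w) < (f2 p2 \<bullet> n) * (f1 p2 \<bullet> w)"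
  obtains y T x U where "integral_curve f2 y T" "integral_curve f1 x U" "y T = x 0" "x U = y 0" "y 0 \<noteq> y T"
    "y ` {0..T} \<subseteq> cball p r" "x ` {0..U} \<subseteq> cball p r"
proof -
  let ?C = "cball p r"
  let ?F1 = "\<lambda>q. (1 / (f1 q \<bullet> w)) *\<^sub>R f1 q" and ?F2 = "\<lambda>q. (1 / (f2 q \<bullet> w)) *\<^sub>R f2 q"
  have sgn: "f1 q \<bullet> w < 0" "0 < f2 q \<bullet> w" if "q \<in> ?C" for q
    using c(1) c(2)[OF that] c(3)[OF that] by linarith+
  obtain K1 where K1: "K1-lipschitz_on ?C ?F1"
    by (rule lipschitz_on_normalized[OF compact_cball lip(1) c(1), of w]) (use c(2) in force)
  obtain K2 where K2: "K2-lipschitz_on ?C ?F2"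
    by (rule lipschitz_on_normalized[OF compact_cball lip(2) c(1), of w]) (use c(3) in force)
  define K where "K = max K1 K2"
  have K: "K-lipschitz_on ?C ?F1" "K-lipschitz_on ?C ?F2"
    by (rule lipschitz_on_mono[OF K1]; simp add: K_def) (rule lipschitz_on_mono[OF K2]; simp add: K_def)
  have diff: "(?F2 q - ?F1 q) \<bullet> n = ((f2 q \<bullet> n) * (f1 q \<bullet> w) - (f1 q \<bullet> n) * (f2 q \<bullet> w)) / ((f1 q \<bullet> w) * (f2 q \<bullet> w))"
    if "q \<in> ?C" for q
    using sgn[OF that] by (simp add: inner_diff_left field_simps)
  have neg: "(f1 q \<bullet> w) * (f2 q \<bullet> w) < 0" if "q \<in> ?C" for q
    using sgn[OF that] by (simp add: mult_neg_pos)
  have pC: "p1 \<in> ?C" "p2 \<in> ?C" using p1(1) p2(1) by auto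
  have e1: "0 < (?F2 p1 - ?F1 p1) \<bullet> n"
    unfolding diff[OF pC(1)] using p1(2) neg[OF pC(1)] by (intro divide_neg_neg) auto
  have e2: "(?F2 p2 - ?F1 p2) \<bullet> n < 0"
    unfolding diff[OF pC(2)] using p2(2) neg[OF pC(2)] by (intro divide_pos_neg) auto
  have unit: "?F1 q \<bullet> w = 1" "?F2 q \<bullet> w = 1" if "q \<in> ?C" for q
    using sgn[OF that] by auto
  obtain h x y where xy: "integral_curve ?F1 x h" "integral_curve ?F2 y h" "x 0 = y 0" "x h = y h"
    "x ` {0..h} \<subseteq> ?C" "y ` {0..h} \<subseteq> ?C"
    by (rule normalized_curves_meet[OF K unit span p1(1) e1 p2(1) e2])
  have h: "0 < h" using xy(1) unfolding integral_curve_def by blast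
  have cf: "continuous_on ?C f1" "continuous_on ?C f2"
    using lip lipschitz_on_continuous_on by blast+
  have yC: "y s \<in> ?C" if "s \<in> {0..h}" for s using xy(6) that by blast
  define x' where "x' s = x (h - s)" for s
  have x'C: "x' s \<in> ?C" if "s \<in> {0..h}" for s using xy(5) that unfolding x'_def by (auto simp: image_subset_iff)
  have x': "integral_curve (\<lambda>q. - ?F1 q) x' h"
    unfolding x'_def by (rule integral_curve_reverse) (use xy(1) in simp)
  obtain z T where z: "integral_curve f2 z T" "z 0 = y 0" "z T = y h" "z ` {0..T} \<subseteq> y ` {0..h}"
  proof (rule integral_curve_time_change[OF xy(2), of "\<lambda>s. 1 / (f2 (y s) \<bullet> w)" f2])
    show "continuous_on {0..h} (\<lambda>s. 1 / (f2 (y s) \<bullet> w))"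
      using yC sgn(2) integral_curve_continuous[OF xy(2)]
      by (intro continuous_intros continuous_on_compose2[OF cf(2)]) (force simp: image_subset_iff)+
  qed (use yC sgn(2) in auto)
  obtain u U where u: "integral_curve f1 u U" "u 0 = x' 0" "u U = x' h" "u ` {0..U} \<subseteq> x' ` {0..h}"
  proof (rule integral_curve_time_change[OF x', of "\<lambda>s. - 1 / (f1 (x' s) \<bullet> w)" f1])
    show "continuous_on {0..h} (\<lambda>s. - 1 / (f1 (x' s) \<bullet> w))"
      using x'C sgn(1) integral_curve_continuous[OF x']
      by (intro continuous_intros continuous_on_compose2[OF cf(1)]) (force simp: image_subset_iff)+
  qed (use x'C sgn(1) in \<open>auto simp: divide_neg_neg\<close>)
  have "y 0 \<bullet> w + 1 * (h - 0) \<le> y h \<bullet> w"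
    by (rule integral_curve_speed[OF xy(2)]) (use h unit(2) yC in force)+
  then have "y 0 \<noteq> y h" using h by auto
  then show thesis
    using that[OF z(1) u(1)] z u xy yC x'C by (force simp: x'_def image_subset_iff)
qed

section \<open>The fields near the singular point\<close>

text \<open>The ball is centred at \<open>a - s ew\<close> and has a radius proportional to \<open>s\<close>. There \<open>f1\<close> is
\<open>- s w + s A u\<close> up to an error that is a small multiple of \<open>s\<close>, where \<open>s u\<close> is the displacement
from the centre. Choosing \<open>u\<close> as a small multiple of \<open>en\<close> or of \<open>- en\<close> adds a positive or negative
multiple of \<open>n\<close> to \<open>f1\<close>, while \<open>f2\<close> stays close to \<open>w\<close>.\<close>

lemma opposed_fields_near_singular_point:
  fixes f1 f2 :: "'a::euclidean_space \<Rightarrow> 'a"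
  assumes A: "(f1 has_derivative A) (at a)" "f1 a = 0" "A ew = w" "A en = n"
    and f2: "continuous (at a) f2" "f2 a = w"
    and w: "w \<noteq> 0" "n \<bullet> w = 0" "norm n = norm w" and "0 < \<delta>"
  obtains p r c p1 p2 where "cball p r \<subseteq> ball a \<delta>" "0 < c" "\<And>q. q \<in> cball p r \<Longrightarrow> f1 q \<bullet> w \<le> - c"
    "p1 \<in> ball p r" "(f2 p1 \<bullet> n) * (f1 p1 \<bullet> w) < (f1 p1 \<bullet> n) * (f2 p1 \<bullet> w)"
    "p2 \<in> ball p r" "(f1 p2 \<bullet> n) * (f2 p2 \<bullet> w) < (f2 p2 \<bullet> n) * (f1 p2 \<bullet> w)"
proof -
  interpret A: bounded_linear A using A(1) by (rule has_derivative_bounded_linear)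
  define W where "W = norm w"
  have W: "0 < W" using w by (simp add: W_def)
  have ww: "w \<bullet> w = W * W" by (simp add: W_def dot_square_norm power2_eq_square)
  obtain B where B: "0 < B" "\<And>u. norm (A u) \<le> norm u * B" using A.pos_bounded by blast
  \<comment> \<open>For \<open>norm u \<le> \<rho>\<close> the vector \<open>A u\<close> cannot spoil the direction of \<open>A u - w\<close>; the offset
    \<open>\<sigma> en\<close> is such a \<open>u\<close>, and all further errors are kept small compared with \<open>\<sigma>\<close>.\<close>
  define \<rho> where "\<rho> = W / (4 * B)"
  have \<rho>: "0 < \<rho>" using W B by (simp add: \<rho>_def)
  have Au: "norm (A u) \<le> W / 4" if "norm u \<le> \<rho>" for u
  proof -
    have "norm (A u) \<le> \<rho> * B" using B(2)[of u] mult_right_mono[OF that, of B] B(1) by linarith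
    then show ?thesis using B(1) by (simp add: \<rho>_def)
  qed
  define \<sigma> where "\<sigma> = min 1 (\<rho> / (2 * (norm en + 1)))"
  have \<sigma>: "0 < \<sigma>" "\<sigma> \<le> 1" "\<sigma> * norm en < \<rho>"
  proof -
    have d: "0 < 2 * (norm en + 1)" by (simp add: add_nonneg_pos)
    show "0 < \<sigma>" "\<sigma> \<le> 1" using \<rho> d by (auto simp: \<sigma>_def)
    have "\<sigma> * norm en \<le> \<rho> / (2 * (norm en + 1)) * norm en"
      by (intro mult_right_mono) (auto simp: \<sigma>_def)
    also have "\<dots> < \<rho>" using \<rho> d by (simp add: field_simps add_nonneg_pos)
    finally show "\<sigma> * norm en < \<rho>" .
  qed
  define R where "R = norm ew + \<rho>"
  have R: "0 < R" using \<rho> by (simp add: R_def add_nonneg_pos)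
  define e where "e = \<sigma> * W / (4 * R)"
  have e: "0 < e" using \<sigma> W R by (simp add: e_def)
  obtain d1 where d1: "0 < d1" "\<And>q. norm (q - a) < d1 \<Longrightarrow> norm (f1 q - A (q - a)) \<le> e * norm (q - a)"
    using A(1,2) e unfolding has_derivative_at_alt by auto
  obtain d2 where d2: "0 < d2" "\<And>q. norm (q - a) < d2 \<Longrightarrow> norm (f2 q - w) < \<sigma> / 8 * W"
    using f2(1) \<sigma>(1) W unfolding continuous_at_eps_delta f2(2)
    by (metis dist_norm divide_pos_pos mult_pos_pos zero_less_numeral)
  \<comment> \<open>The ball lies within distance \<open>s R\<close> of \<open>a\<close>, where both approximations are good enough.\<close>
  define s where "s = min d1 (min d2 \<delta>) / (2 * R)"
  have s: "0 < s" "s * R < d1" "s * R < d2" "s * R < \<delta>"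
  proof -
    have m: "0 < min d1 (min d2 \<delta>)" using d1 d2 \<open>0 < \<delta>\<close> by simp
    then show "0 < s" using R by (simp add: s_def)
    have "s * R = min d1 (min d2 \<delta>) / 2" using R by (simp add: s_def)
    then show "s * R < d1" "s * R < d2" "s * R < \<delta>" using m by linarith+
  qed
  define p where "p = a - s *\<^sub>R ew"
  define r where "r = s * \<rho>"
  have near: "norm (q - a) \<le> s * R" if "q \<in> cball p r" for q
  proof -
    have "norm (q - a) \<le> norm (q - p) + norm (p - a)" using norm_triangle_ineq[of "q - p" "p - a"] by simp
    also have "\<dots> \<le> s * \<rho> + s * norm ew"
      using that s(1) by (intro add_mono) (auto simp: p_def r_def dist_norm norm_minus_commute)
    finally show ?thesis by (simp add: R_def algebra_simps)
  qed
  have eR: "e * (s * R) = s * \<sigma> * W / 4" using R by (simp add: e_def)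
  \<comment> \<open>On the ball, \<open>f1 q\<close> is \<open>s\<close> times \<open>A u - w\<close> up to an error that is small compared with \<open>s\<close>.\<close>
  have expand: "norm (f1 (p + s *\<^sub>R u) - s *\<^sub>R (A u - w)) \<le> s * \<sigma> * W / 4" if "norm u \<le> \<rho>" for u
  proof -
    let ?q = "p + s *\<^sub>R u"
    have q: "?q \<in> cball p r" using that s(1) by (simp add: r_def dist_norm)
    have "A (?q - a) = s *\<^sub>R (A u - w)"
      by (simp add: p_def A.diff A.add A.scaleR A.neg A(3) algebra_simps)
    moreover have "norm (f1 ?q - A (?q - a)) \<le> e * norm (?q - a)"
      using d1(2)[of ?q] near[OF q] s(2) by linarith
    moreover have "e * norm (?q - a) \<le> e * (s * R)"
      using near[OF q] e by (intro mult_left_mono) auto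
    ultimately show ?thesis using eR by simp
  qed
  have inner_le: "\<bar>v \<bullet> m\<bar> \<le> b * W" if "norm v \<le> b" "norm m = W" for v m :: 'a and b
    using Cauchy_Schwarz_ineq2[of v m] mult_right_mono[OF that(1), of W] W unfolding that(2) by linarith
  have f1w: "\<bar>f1 (p + s *\<^sub>R u) \<bullet> w - s * (A u \<bullet> w - W * W)\<bar> \<le> s * \<sigma> * W / 4 * W" if "norm u \<le> \<rho>" for u
    using inner_le[OF expand[OF that], of w] by (simp add: inner_diff_left ww W_def)
  \<comment> \<open>Up to the errors, \<open>f1 q\<close> is \<open>s (\<sigma> m - w)\<close> and \<open>f2 q\<close> is \<open>w\<close>.\<close>
  have cone: "(f2 q \<bullet> m) * (f1 q \<bullet> w) < (f1 q \<bullet> m) * (f2 q \<bullet> w)"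
    if m: "A u = \<sigma> *\<^sub>R m" "norm u \<le> \<rho>" "norm m = W" "m \<bullet> w = 0" and q: "q = p + s *\<^sub>R u" for m u q
  proof -
    have qC: "q \<in> cball p r" using q m(2) s(1) by (simp add: r_def dist_norm)
    have mm: "m \<bullet> m = W * W" using m(3) by (simp add: dot_square_norm power2_eq_square)
    let ?t = "s * \<sigma> * (W * W)"
    have t: "0 < ?t" "?t \<le> s * (W * W)"
      using s(1) \<sigma> W by (auto simp: mult_le_cancel_right1)
    have "w \<bullet> m = 0" using m(4) by (simp add: inner_commute)
    then have "(f1 q - s *\<^sub>R (A u - w)) \<bullet> m = f1 q \<bullet> m - ?t"
      by (simp add: m(1) inner_diff_left mm)
    then have "\<bar>f1 q \<bullet> m - ?t\<bar> \<le> ?t / 4"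
      using inner_le[OF expand[OF m(2)] m(3)] by (simp add: q mult_ac)
    then have a1: "3 / 4 * ?t \<le> f1 q \<bullet> m" by linarith
    have "\<bar>f1 q \<bullet> w + s * (W * W)\<bar> \<le> ?t / 4"
      using f1w[OF m(2)] m by (simp add: q mult_ac)
    then have a2: "f1 q \<bullet> w < 0" "- (f1 q \<bullet> w) \<le> 5 / 4 * (s * (W * W))" using t by linarith+
    have f2q: "norm (f2 q - w) \<le> \<sigma> / 8 * W" using d2(2)[of q] near[OF qC] s(3) by linarith
    have "\<bar>f2 q \<bullet> m\<bar> \<le> \<sigma> / 8 * (W * W)"
      using inner_le[OF f2q m(3)] \<open>w \<bullet> m = 0\<close> by (simp add: inner_diff_left mult.assoc)
    then have a3: "- (f2 q \<bullet> m) \<le> \<sigma> / 8 * (W * W)" by linarith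
    have "\<bar>f2 q \<bullet> w - W * W\<bar> \<le> \<sigma> / 8 * (W * W)"
      using inner_le[OF f2q, of w] by (simp add: inner_diff_left ww W_def)
    moreover have "\<sigma> / 8 * (W * W) \<le> 1 / 8 * (W * W)" using \<sigma>(2) W by (intro mult_right_mono) auto
    ultimately have a4: "7 / 8 * (W * W) \<le> f2 q \<bullet> w" by linarith
    have "(f2 q \<bullet> m) * (f1 q \<bullet> w) = - (f2 q \<bullet> m) * (- (f1 q \<bullet> w))" by simp
    also have "\<dots> \<le> (\<sigma> / 8 * (W * W)) * (- (f1 q \<bullet> w))"
      using a2(1) a3 by (intro mult_right_mono) auto
    also have "\<dots> \<le> (\<sigma> / 8 * (W * W)) * (5 / 4 * (s * (W * W)))"
      using a2(2) \<sigma>(1) W by (intro mult_left_mono) auto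
    also have "\<dots> = 5 / 32 * (?t * (W * W))" by simp
    also have "\<dots> < 21 / 32 * (?t * (W * W))" using t W by (intro mult_strict_right_mono) auto
    also have "\<dots> = (3 / 4 * ?t) * (7 / 8 * (W * W))" by simp
    also have "\<dots> \<le> (f1 q \<bullet> m) * (f2 q \<bullet> w)"
      using a1 a4 t W by (intro mult_mono) auto
    finally show ?thesis .
  qed
  have ball: "p + s *\<^sub>R u \<in> ball p r" if "norm u < \<rho>" for u
    using that s(1) by (simp add: r_def dist_norm)
  show thesis
  proof (rule that[of p r "s * (W * W) / 2" "p + s *\<^sub>R (\<sigma> *\<^sub>R en)" "p + s *\<^sub>R (\<sigma> *\<^sub>R (- en))"])
    show "cball p r \<subseteq> ball a \<delta>"
    proof
      fix q assume "q \<in> cball p r"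
      from near[OF this] s(4) show "q \<in> ball a \<delta>" by (simp add: dist_norm norm_minus_commute)
    qed
    show "0 < s * (W * W) / 2" using s(1) W by simp
    show "f1 q \<bullet> w \<le> - (s * (W * W) / 2)" if "q \<in> cball p r" for q
    proof -
      define u where "u = (1 / s) *\<^sub>R (q - p)"
      have q: "q = p + s *\<^sub>R u" using s(1) by (simp add: u_def)
      have u: "norm u \<le> \<rho>"
      proof -
        have "norm u = norm (q - p) / s" using s(1) by (simp add: u_def)
        also have "\<dots> \<le> s * \<rho> / s"
          using that s(1) by (intro divide_right_mono) (auto simp: r_def dist_norm norm_minus_commute)
        finally show ?thesis using s(1) by simp
      qed
      have "A u \<bullet> w \<le> W / 4 * W" using inner_le[OF Au[OF u], of w] by (simp add: W_def)
      then have "s * (A u \<bullet> w) \<le> s * (W / 4 * W)" using s(1) by (intro mult_left_mono) auto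
      then have b1: "s * (A u \<bullet> w) \<le> s * (W * W) / 4" by simp
      have "s * \<sigma> * (W * W) \<le> s * 1 * (W * W)"
        using s(1) \<sigma>(2) W by (intro mult_right_mono mult_left_mono) auto
      then have b2: "s * \<sigma> * (W * W) / 4 \<le> s * (W * W) / 4" by simp
      have "\<bar>f1 q \<bullet> w - (s * (A u \<bullet> w) - s * (W * W))\<bar> \<le> s * \<sigma> * (W * W) / 4"
        using f1w[OF u] unfolding q[symmetric] right_diff_distrib by simp
      then show ?thesis using b1 b2 unfolding abs_le_iff by linarith
    qed
    have su: "norm (\<sigma> *\<^sub>R en) < \<rho>" "norm (\<sigma> *\<^sub>R (- en)) < \<rho>" using \<sigma> by auto
    show "p + s *\<^sub>R (\<sigma> *\<^sub>R en) \<in> ball p r" "p + s *\<^sub>R (\<sigma> *\<^sub>R (- en)) \<in> ball p r"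
      using ball su by blast+
    let ?p1 = "p + s *\<^sub>R (\<sigma> *\<^sub>R en)" and ?p2 = "p + s *\<^sub>R (\<sigma> *\<^sub>R (- en))"
    show "(f2 ?p1 \<bullet> n) * (f1 ?p1 \<bullet> w) < (f1 ?p1 \<bullet> n) * (f2 ?p1 \<bullet> w)"
      by (rule cone[OF _ less_imp_le[OF su(1)] _ _ refl]) (use w A(4) in \<open>auto simp: W_def A.scaleR\<close>)
    have "(f2 ?p2 \<bullet> - n) * (f1 ?p2 \<bullet> w) < (f1 ?p2 \<bullet> - n) * (f2 ?p2 \<bullet> w)"
      by (rule cone[OF _ less_imp_le[OF su(2)] _ _ refl]) (use w A(4) in \<open>auto simp: W_def A.scaleR A.neg\<close>)
    then show "(f1 ?p2 \<bullet> n) * (f2 ?p2 \<bullet> w) < (f2 ?p2 \<bullet> n) * (f1 ?p2 \<bullet> w)" by simp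
  qed
qed

section \<open>Piecewise smooth runs and reachability\<close>

definition switching_run ::
  "('a::real_normed_vector \<Rightarrow> 'a) \<Rightarrow> ('a \<Rightarrow> 'a) \<Rightarrow> 'a set \<Rightarrow> (real \<Rightarrow> 'a) \<Rightarrow> real \<Rightarrow> real \<Rightarrow> bool"
where
  "switching_run f1 f2 V x a b \<longleftrightarrow>
     a < b \<and> x piecewise_C1_differentiable_on {a..b} \<and> x ` {a..b} \<subseteq> V \<and>
     (\<exists>S. finite S \<and> (\<forall>t\<in>{a..b} - S. \<exists>y\<in>{f1 (x t), f2 (x t)}. (x has_vector_derivative y) (at t)))"

lemma switching_run_continuous: "switching_run f1 f2 V x a b \<Longrightarrow> continuous_on {a..b} x"
  by (simp add: switching_run_def piecewise_C1_differentiable_on_def)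

lemma switching_run_mono: "switching_run f1 f2 V x a b \<Longrightarrow> V \<subseteq> W \<Longrightarrow> switching_run f1 f2 W x a b"
  unfolding switching_run_def by blast

lemma switching_run_subinterval:
  assumes run: "switching_run f1 f2 V x a b" and "a \<le> c" "c < d" "d \<le> b"
  shows "switching_run f1 f2 V x c d"
proof -
  have sub: "{c..d} \<subseteq> {a..b}" using assms by auto
  obtain S where S: "finite S" "\<forall>t\<in>{a..b} - S. \<exists>v\<in>{f1 (x t), f2 (x t)}. (x has_vector_derivative v) (at t)"
    using run unfolding switching_run_def by blast
  have "x piecewise_C1_differentiable_on {c..d}"
    using run sub unfolding switching_run_def by (blast intro: piecewise_C1_differentiable_on_subset)
  moreover have "x ` {c..d} \<subseteq> V"
    using run sub unfolding switching_run_def by blast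
  moreover have "\<forall>t\<in>{c..d} - S. \<exists>v\<in>{f1 (x t), f2 (x t)}. (x has_vector_derivative v) (at t)"
    using S(2) sub by blast
  ultimately show ?thesis
    using S(1) \<open>c < d\<close> unfolding switching_run_def by blast
qed

lemma switching_run_cong:
  assumes run: "switching_run f1 f2 V x a b" and eq: "\<And>t. t \<in> {a..b} \<Longrightarrow> y t = x t"
  shows "switching_run f1 f2 V y a b"
proof -
  obtain S where S: "finite S" "\<forall>t\<in>{a..b} - S. \<exists>v\<in>{f1 (x t), f2 (x t)}. (x has_vector_derivative v) (at t)"
    using run unfolding switching_run_def by blast
  obtain R D where R: "finite R" "\<forall>t\<in>{a..b} - R. (x has_vector_derivative D t) (at t)"
      "continuous_on ({a..b} - R) D"
    using run unfolding switching_run_def piecewise_C1_differentiable_on_def C1_differentiable_on_def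
    by blast
  have transfer: "(y has_vector_derivative v) (at t)"
    if "(x has_vector_derivative v) (at t)" "t \<in> {a<..<b}" for v t
    by (rule has_vector_derivative_transform_within_open[OF that(1) open_greaterThanLessThan that(2)])
      (use eq in auto)
  have "y C1_differentiable_on ({a..b} - (R \<union> {a, b}))"
    unfolding C1_differentiable_on_def
    using R transfer by (intro exI[of _ D]) (auto intro: continuous_on_subset)
  moreover have "continuous_on {a..b} y"
    using continuous_on_eq[OF switching_run_continuous[OF run], of y] eq by simp
  ultimately have "y piecewise_C1_differentiable_on {a..b}"
    using \<open>finite R\<close> unfolding piecewise_C1_differentiable_on_def
    by (intro conjI exI[of _ "R \<union> {a, b}"]) simp_all
  moreover have "\<forall>t\<in>{a..b} - (S \<union> {a, b}). \<exists>v\<in>{f1 (y t), f2 (y t)}. (y has_vector_derivative v) (at t)"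
  proof
    fix t assume t: "t \<in> {a..b} - (S \<union> {a, b})"
    then obtain v where "v \<in> {f1 (x t), f2 (x t)}" "(x has_vector_derivative v) (at t)"
      using S(2) by blast
    moreover have "t \<in> {a<..<b}" using t by auto
    ultimately show "\<exists>v\<in>{f1 (y t), f2 (y t)}. (y has_vector_derivative v) (at t)"
      using transfer eq t by auto
  qed
  moreover have "y ` {a..b} \<subseteq> V" "a < b"
    using run eq unfolding switching_run_def by auto
  ultimately show ?thesis
    using S(1) unfolding switching_run_def
    by (intro conjI exI[of _ "S \<union> {a, b}"]) simp_all
qed

lemma switching_run_shift:
  assumes run: "switching_run f1 f2 V x a b"
  shows "switching_run f1 f2 V (\<lambda>t. x (t - c)) (a + c) (b + c)"
proof -
  obtain S where S: "finite S" "\<forall>t\<in>{a..b} - S. \<exists>v\<in>{f1 (x t), f2 (x t)}. (x has_vector_derivative v) (at t)"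
    using run unfolding switching_run_def by blast
  have img: "(\<lambda>t. t - c) ` {a + c..b + c} = {a..b}"
    by (auto simp: image_iff intro!: bexI[of _ "_ + c"])
  have "(x \<circ> (\<lambda>t. t - c)) piecewise_C1_differentiable_on {a + c..b + c}"
  proof (rule piecewise_C1_differentiable_compose)
    show "(\<lambda>t. t - c) piecewise_C1_differentiable_on {a + c..b + c}"
      by (intro C1_differentiable_imp_piecewise C1_differentiable_on_diff) auto
    show "x piecewise_C1_differentiable_on (\<lambda>t. t - c) ` {a + c..b + c}"
      using run unfolding img switching_run_def by simp
    show "finite ({a + c..b + c} \<inter> (\<lambda>t. t - c) -` {u})" for u
      by (rule finite_subset[of _ "{u + c}"]) auto
  qed
  moreover have "\<exists>v\<in>{f1 (x (t - c)), f2 (x (t - c))}. ((\<lambda>t. x (t - c)) has_vector_derivative v) (at t)"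
    if "t \<in> {a + c..b + c} - (\<lambda>t. t + c) ` S" for t
  proof -
    have "t - c \<in> {a..b} - S" using that by (auto simp: image_iff)
    then obtain v where v: "v \<in> {f1 (x (t - c)), f2 (x (t - c))}" "(x has_vector_derivative v) (at (t - c))"
      using S(2) by blast
    have "((\<lambda>t. t - c) has_vector_derivative 1) (at t)"
      by (auto intro!: derivative_eq_intros)
    from vector_diff_chain_at[OF this v(2)] v(1) show ?thesis by (auto simp: o_def)
  qed
  moreover have "finite ((\<lambda>t. t + c) ` S)" using S(1) by simp
  moreover have "(\<lambda>t. x (t - c)) ` {a + c..b + c} \<subseteq> V"
    using run img unfolding switching_run_def by auto
  moreover have "a + c < b + c" using run unfolding switching_run_def by simp
  ultimately show ?thesis
    unfolding switching_run_def o_def by blast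
qed

lemma switching_run_join:
  assumes x: "switching_run f1 f2 V x a b" and y: "switching_run f1 f2 V y b c" and eq: "x b = y b"
  shows "switching_run f1 f2 V (\<lambda>t. if t \<le> b then x t else y t) a c"
proof -
  let ?z = "\<lambda>t. if t \<le> b then x t else y t"
  have "a < b" "b < c" using x y unfolding switching_run_def by auto
  have zx: "switching_run f1 f2 V ?z a b"
    by (rule switching_run_cong[OF x]) auto
  have zy: "switching_run f1 f2 V ?z b c"
    by (rule switching_run_cong[OF y]) (use eq in auto)
  obtain S where S: "finite S" "\<forall>t\<in>{a..b} - S. \<exists>v\<in>{f1 (?z t), f2 (?z t)}. (?z has_vector_derivative v) (at t)"
    using zx unfolding switching_run_def by blast
  obtain R where R: "finite R" "\<forall>t\<in>{b..c} - R. \<exists>v\<in>{f1 (?z t), f2 (?z t)}. (?z has_vector_derivative v) (at t)"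
    using zy unfolding switching_run_def by blast
  have pC1: "?z piecewise_C1_differentiable_on {a..c}"
    by (rule piecewise_C1_differentiable_cases)
      (use x y eq \<open>a < b\<close> \<open>b < c\<close> in \<open>auto simp: switching_run_def\<close>)
  have deriv: "\<forall>t\<in>{a..c} - (S \<union> R). \<exists>v\<in>{f1 (?z t), f2 (?z t)}. (?z has_vector_derivative v) (at t)"
  proof
    fix t assume t: "t \<in> {a..c} - (S \<union> R)"
    show "\<exists>v\<in>{f1 (?z t), f2 (?z t)}. (?z has_vector_derivative v) (at t)"
    proof (cases "t \<le> b")
      case True
      then show ?thesis using t by (intro S(2)[rule_format]) auto
    next
      case False
      then show ?thesis using t by (intro R(2)[rule_format]) auto
    qed
  qed
  have img: "?z ` {a..c} \<subseteq> V"
  proof -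
    have "\<And>t. t \<in> {a..b} \<Longrightarrow> x t \<in> V" "\<And>t. t \<in> {b..c} \<Longrightarrow> y t \<in> V"
      using x y unfolding switching_run_def by blast+
    then show ?thesis by auto
  qed
  have "a < c" using \<open>a < b\<close> \<open>b < c\<close> by simp
  show ?thesis
    unfolding switching_run_def
    by (intro conjI exI[of _ "S \<union> R"] pC1 deriv img \<open>a < c\<close> finite_UnI S(1) R(1))
qed

lemma integral_curve_run:
  fixes f1 f2 :: "'a::real_normed_vector \<Rightarrow> 'a"
  assumes x: "integral_curve f x T" and f: "f = f1 \<or> f = f2" "continuous_on UNIV f"
    and V: "x ` {0..T} \<subseteq> V"
  shows "switching_run f1 f2 V x 0 T"
proof -
  have "continuous_on ({0..T} - {0, T}) (\<lambda>t. f (x t))"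
    by (rule continuous_on_compose2[OF f(2)])
      (auto intro: continuous_on_subset[OF integral_curve_continuous[OF x]])
  moreover have d: "\<forall>t\<in>{0..T} - {0, T}. (x has_vector_derivative f (x t)) (at t)"
    using x unfolding integral_curve_def by auto
  ultimately have "x C1_differentiable_on ({0..T} - {0, T})"
    unfolding C1_differentiable_on_def by (intro exI[of _ "\<lambda>t. f (x t)"] conjI)
  then have "x piecewise_C1_differentiable_on {0..T}"
    using integral_curve_continuous[OF x] unfolding piecewise_C1_differentiable_on_def
    by (intro conjI exI[of _ "{0, T}"]) auto
  moreover have "0 < T" using x unfolding integral_curve_def by blast
  ultimately show ?thesis
    using d f(1) V unfolding switching_run_def by (intro conjI exI[of _ "{0, T}"]) auto
qed

definition reaches ::
  "('a::real_normed_vector \<Rightarrow> 'a) \<Rightarrow> ('a \<Rightarrow> 'a) \<Rightarrow> 'a set \<Rightarrow> 'a \<Rightarrow> 'a \<Rightarrow> bool" where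
  "reaches f1 f2 V p q \<longleftrightarrow> (\<exists>x a b. switching_run f1 f2 V x a b \<and> x a = p \<and> x b = q)"

lemma reaches_from:
  assumes "reaches f1 f2 V p q"
  obtains x b where "switching_run f1 f2 V x a b" "x a = p" "x b = q"
proof -
  obtain x c d where x: "switching_run f1 f2 V x c d" "x c = p" "x d = q"
    using assms unfolding reaches_def by blast
  from switching_run_shift[OF x(1), of "a - c"] x(2,3)
  show thesis by (intro that[of "\<lambda>t. x (t - (a - c))" "d + (a - c)"]) simp_all
qed

lemma reaches_trans:
  assumes "reaches f1 f2 V p q" "reaches f1 f2 V q r"
  shows "reaches f1 f2 V p r"
proof -
  obtain x a b where x: "switching_run f1 f2 V x a b" "x a = p" "x b = q"
    using assms(1) unfolding reaches_def by blast
  obtain y c where y: "switching_run f1 f2 V y b c" "y b = q" "y c = r"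
    using reaches_from[OF assms(2)] .
  have "a < b" "b < c" using x y unfolding switching_run_def by auto
  let ?z = "\<lambda>t. if t \<le> b then x t else y t"
  have "switching_run f1 f2 V ?z a c"
    using switching_run_join[OF x(1) y(1)] x(3) y(2) by simp
  moreover have "?z a = p" "?z c = r"
    using \<open>a < b\<close> \<open>b < c\<close> x(2) y(3) by auto
  ultimately show ?thesis
    unfolding reaches_def by (intro exI[of _ ?z] exI[of _ a] exI[of _ c] conjI)
qed

lemma reaches_mono: "reaches f1 f2 V p q \<Longrightarrow> V \<subseteq> W \<Longrightarrow> reaches f1 f2 W p q"
  unfolding reaches_def using switching_run_mono[of f1 f2 V _ _ _ W] by metis

lemma closed_run_all_reach:
  assumes run: "switching_run f1 f2 V x a b" and closed: "x a = x b"
    and pq: "p \<in> x ` {a..b}" "q \<in> x ` {a..b}"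
  shows "reaches f1 f2 (x ` {a..b}) p q"
proof -
  let ?K = "x ` {a..b}"
  have run': "switching_run f1 f2 ?K x a b" using run unfolding switching_run_def by blast
  have sub: "reaches f1 f2 ?K (x s) (x t)" if "a \<le> s" "s < t" "t \<le> b" for s t
    using switching_run_subinterval[OF run' that] unfolding reaches_def by blast
  have "a < b" using run unfolding switching_run_def by blast
  obtain s t where st: "s \<in> {a..b}" "p = x s" "t \<in> {a..b}" "q = x t" using pq by blast
  have "reaches f1 f2 ?K p (x b)"
    using sub[of s b] sub[of a b] st closed \<open>a < b\<close> by (cases "s = b") auto
  moreover have "reaches f1 f2 ?K (x a) q"
    using sub[of a t] sub[of a b] st closed \<open>a < b\<close> by (cases "t = a") auto
  ultimately show ?thesis using closed reaches_trans by metis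
qed

text \<open>A point of \<open>inside K\<close> is carried by \<open>f2\<close> to the frontier of that set, hence to \<open>K\<close>, both
forwards and backwards in time. So it reaches \<open>K\<close> and is reached from
\<open>K\<close>, and within \<open>K\<close> everything is joined already.\<close>

lemma filled_all_reach:
  fixes f1 f2 :: "'a::euclidean_space \<Rightarrow> 'a"
  assumes K: "compact K" "K \<subseteq> C" "\<And>p q. p \<in> K \<Longrightarrow> q \<in> K \<Longrightarrow> reaches f1 f2 K p q"
    and C: "compact C" "convex C" and lip: "L-lipschitz_on C f2" and cont: "continuous_on UNIV f2"
    and speed: "0 < \<kappa>" "\<And>q. q \<in> C \<Longrightarrow> \<kappa> \<le> f2 q \<bullet> w"
    and pq: "p \<in> K \<union> inside K" "q \<in> K \<union> inside K"
  shows "reaches f1 f2 (K \<union> inside K) p q"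
proof -
  let ?V = "K \<union> inside K"
  have cl: "closed K" using K(1) by (rule compact_imp_closed)
  have G: "open (inside K)" "inside K \<subseteq> C"
    using open_inside[OF cl] outside_subset_convex[OF C(2) K(2)] inside_Int_outside[of K] by blast+
  have fr: "frontier (inside K) \<subseteq> K" "closure (inside K) \<subseteq> ?V"
    using frontier_inside_subset[OF cl] closure_inside_subset[OF cl] by auto
  have into: "\<exists>k\<in>K. reaches f1 f2 ?V p k" if p: "p \<in> ?V" for p
  proof (cases "p \<in> K")
    case True
    then show ?thesis using K(3)[OF True True] reaches_mono[of f1 f2 K p p ?V] by blast
  next
    case False
    then have "p \<in> inside K" using p by blast
    from exits_through_frontier[OF C lip speed G this]
    obtain z T where z: "integral_curve f2 z T" "z 0 = p" "z T \<in> frontier (inside K)"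
      "z ` {0..T} \<subseteq> closure (inside K)" by blast
    then have "switching_run f1 f2 ?V z 0 T"
      using fr by (intro integral_curve_run[of f2] cont) auto
    then show ?thesis using z fr unfolding reaches_def by blast
  qed
  have out: "\<exists>k\<in>K. reaches f1 f2 ?V k p" if p: "p \<in> ?V" for p
  proof (cases "p \<in> K")
    case True
    then show ?thesis using K(3)[OF True True] reaches_mono[of f1 f2 K p p ?V] by blast
  next
    case False
    then have "p \<in> inside K" using p by blast
    moreover have "L-lipschitz_on C (\<lambda>q. - f2 q)" using lip by simp
    moreover have "\<kappa> \<le> - f2 q \<bullet> - w" if "q \<in> C" for q using speed(2)[OF that] by simp
    ultimately obtain z T where z: "integral_curve (\<lambda>q. - f2 q) z T" "z 0 = p" "z T \<in> frontier (inside K)"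
      "z ` {0..T} \<subseteq> closure (inside K)"
      using exits_through_frontier[OF C _ speed(1) _ G, of L "\<lambda>q. - f2 q" "- w" p] by blast
    have rev: "integral_curve f2 (\<lambda>t. z (T - t)) T" by (rule integral_curve_reverse[OF z(1)])
    have "(\<lambda>t. z (T - t)) ` {0..T} \<subseteq> ?V"
      using z(4) fr(2) by (force simp: image_subset_iff)
    then have "switching_run f1 f2 ?V (\<lambda>t. z (T - t)) 0 T"
      by (intro integral_curve_run[OF rev] cont) auto
    then show ?thesis using z fr unfolding reaches_def
      by (intro bexI[of _ "z T"] exI[of _ "\<lambda>t. z (T - t)"] exI[of _ 0] exI[of _ T]) auto
  qed
  obtain k l where "k \<in> K" "reaches f1 f2 ?V p k" "l \<in> K" "reaches f1 f2 ?V l q"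
    using into[OF pq(1)] out[OF pq(2)] by blast
  moreover have "reaches f1 f2 ?V k l"
    using K(3)[OF \<open>k \<in> K\<close> \<open>l \<in> K\<close>] by (rule reaches_mono) blast
  ultimately show ?thesis using reaches_trans by blast
qed

section \<open>Lipschitz runs on arbitrary time sets\<close>

lemma lipschitz_on_glue:
  fixes x :: "real \<Rightarrow> 'a::metric_space"
  assumes "M-lipschitz_on A x" "M-lipschitz_on B x" "b \<in> A" "b \<in> B" "A \<subseteq> {..b}" "B \<subseteq> {b..}"
  shows "M-lipschitz_on (A \<union> B) x"
proof (rule lipschitz_onI)
  show "0 \<le> M" using assms(1) lipschitz_on_nonneg by blast
  have across: "dist (x s) (x t) \<le> M * dist s t" if "s \<in> A" "t \<in> B" for s t
  proof -
    have "dist (x s) (x t) \<le> dist (x s) (x b) + dist (x b) (x t)" by (rule dist_triangle)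
    also have "\<dots> \<le> M * dist s b + M * dist b t"
      using that assms(1-4) by (intro add_mono lipschitz_onD) auto
    also have "\<dots> = M * dist s t"
    proof -
      have "s \<le> b" "b \<le> t" using that assms(5,6) by auto
      then have "dist s b = b - s" "dist b t = t - b" "dist s t = t - s"
        by (auto simp: dist_real_def)
      then show ?thesis by (simp add: right_diff_distrib)
    qed
    finally show ?thesis .
  qed
  show "dist (x s) (x t) \<le> M * dist s t" if "s \<in> A \<union> B" "t \<in> A \<union> B" for s t
    using that across[of s t] across[of t s] assms(1,2)
    by (auto simp: dist_commute intro: lipschitz_onD)
qed

lemma lipschitz_on_chain:
  fixes x :: "real \<Rightarrow> 'a::metric_space" and t :: "nat \<Rightarrow> real"
  assumes M: "\<And>i. M-lipschitz_on {t i..t (Suc i)} x" and le: "\<And>i. t i \<le> t (Suc i)"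
  shows "M-lipschitz_on (\<Union>i. {t 0..t i}) x"
proof -
  have "0 \<le> M" using lipschitz_on_nonneg[OF M] .
  have mono: "i \<le> j \<Longrightarrow> t i \<le> t j" for i j
    using lift_Suc_mono_le[of t, OF le] .
  have pref: "M-lipschitz_on {t 0..t i} x" for i
  proof (induction i)
    case 0
    then show ?case using \<open>0 \<le> M\<close> by simp
  next
    case (Suc i)
    have "{t 0..t (Suc i)} = {t 0..t i} \<union> {t i..t (Suc i)}"
      using mono[of 0 i] le[of i] by auto
    moreover have "M-lipschitz_on ({t 0..t i} \<union> {t i..t (Suc i)}) x"
      by (rule lipschitz_on_glue[OF Suc M, of "t i"]) (use mono[of 0 i] le[of i] in auto)
    ultimately show ?case by simp
  qed
  show ?thesis
  proof (rule lipschitz_onI[OF _ \<open>0 \<le> M\<close>])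
    fix r s assume "r \<in> (\<Union>i. {t 0..t i})" "s \<in> (\<Union>i. {t 0..t i})"
    then obtain i j where "r \<in> {t 0..t i}" "s \<in> {t 0..t j}" by blast
    then have "r \<in> {t 0..t (max i j)}" "s \<in> {t 0..t (max i j)}"
      using mono[of i "max i j"] mono[of j "max i j"] by auto
    then show "dist (x r) (x s) \<le> M * dist r s"
      using lipschitz_onD[OF pref] by blast
  qed
qed

lemma switching_run_lipschitz:
  fixes f1 f2 :: "'a::banach \<Rightarrow> 'a"
  assumes run: "switching_run f1 f2 V x a b"
    and M: "\<And>p. p \<in> V \<Longrightarrow> norm (f1 p) \<le> M" "\<And>p. p \<in> V \<Longrightarrow> norm (f2 p) \<le> M"
  shows "M-lipschitz_on {a..b} x"
proof -
  have V: "x t \<in> V" if "t \<in> {a..b}" for t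
    using run that unfolding switching_run_def by auto
  have "a < b" using run unfolding switching_run_def by blast
  then have M0: "0 \<le> M" using order_trans[OF norm_ge_zero M(1)[OF V[of a]]] by simp
  obtain S where S: "finite S" "\<forall>t\<in>{a..b} - S. \<exists>v\<in>{f1 (x t), f2 (x t)}. (x has_vector_derivative v) (at t)"
    using run unfolding switching_run_def by blast
  then obtain v where v: "\<And>t. t \<in> {a..b} - S \<Longrightarrow> v t \<in> {f1 (x t), f2 (x t)} \<and> (x has_vector_derivative v t) (at t)"
    by metis
  have le: "norm (x t - x s) \<le> M * (t - s)" if "s \<le> t" "s \<in> {a..b}" "t \<in> {a..b}" for s t
  proof -
    have "(v has_integral (x t - x s)) {s..t}"
    proof (rule fundamental_theorem_of_calculus_strong[OF S(1) \<open>s \<le> t\<close>])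
      show "continuous_on {s..t} x"
        by (rule continuous_on_subset[OF switching_run_continuous[OF run]]) (use that in auto)
    qed (use v that in auto)
    moreover have "norm (v r) \<le> M" if r: "r \<in> {s..t} - S" for r
    proof -
      have "r \<in> {a..b} - S" using r \<open>s \<in> {a..b}\<close> \<open>t \<in> {a..b}\<close> by auto
      then show ?thesis using v[of r] M[OF V[of r]] by auto
    qed
    ultimately have "norm (x t - x s) \<le> M * measure lborel {s..t}"
      using has_integral_bound_real[OF M0 S(1)] by blast
    then show ?thesis using that by simp
  qed
  show ?thesis
  proof (rule lipschitz_onI[OF _ M0])
    fix s t assume st: "s \<in> {a..b}" "t \<in> {a..b}"
    show "dist (x s) (x t) \<le> M * dist s t"
      using le[of s t] le[of t s] st
      by (cases "s \<le> t") (auto simp: dist_norm norm_minus_commute)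
  qed
qed

text \<open>Infinite concatenations have infinitely many switching times, which may accumulate. A countable
exceptional set covers them, and a common Lipschitz constant takes the place of piecewise
smoothness as the reason for absolute continuity.\<close>

definition lipschitz_run ::
  "('a::real_normed_vector \<Rightarrow> 'a) \<Rightarrow> ('a \<Rightarrow> 'a) \<Rightarrow> 'a set \<Rightarrow> real \<Rightarrow> real set \<Rightarrow> (real \<Rightarrow> 'a) \<Rightarrow> bool"
where
  "lipschitz_run f1 f2 V M A x \<longleftrightarrow> M-lipschitz_on A x \<and> x ` A \<subseteq> V \<and>
     (\<exists>S. countable S \<and>
       (\<forall>t\<in>interior A - S. \<exists>y\<in>{f1 (x t), f2 (x t)}. (x has_vector_derivative y) (at t)))"

lemma lipschitz_run_join:
  assumes x: "lipschitz_run f1 f2 V M A x" and y: "lipschitz_run f1 f2 V M B y"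
    and b: "b \<in> A" "b \<in> B" "A \<subseteq> {..b}" "B \<subseteq> {b..}" and eq: "x b = y b"
  shows "lipschitz_run f1 f2 V M (A \<union> B) (\<lambda>t. if t \<le> b then x t else y t)"
proof -
  let ?z = "\<lambda>t. if t \<le> b then x t else y t"
  obtain S where S: "countable S"
    "\<forall>t\<in>interior A - S. \<exists>v\<in>{f1 (x t), f2 (x t)}. (x has_vector_derivative v) (at t)"
    using x unfolding lipschitz_run_def by blast
  obtain R where R: "countable R"
    "\<forall>t\<in>interior B - R. \<exists>v\<in>{f1 (y t), f2 (y t)}. (y has_vector_derivative v) (at t)"
    using y unfolding lipschitz_run_def by blast
  have zx: "?z t = x t" if "t \<in> A" for t using that b by auto
  have zy: "?z t = y t" if "t \<in> B" for t using that b eq by (auto simp: subset_iff)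
  have "M-lipschitz_on A ?z"
    by (rule lipschitz_on_transform[OF _ zx]) (use x in \<open>simp_all add: lipschitz_run_def\<close>)
  moreover have "M-lipschitz_on B ?z"
    by (rule lipschitz_on_transform[OF _ zy]) (use y in \<open>simp_all add: lipschitz_run_def\<close>)
  ultimately have "M-lipschitz_on (A \<union> B) ?z"
    using b by (rule lipschitz_on_glue)
  moreover have "?z ` (A \<union> B) \<subseteq> V"
  proof
    fix p assume "p \<in> ?z ` (A \<union> B)"
    then obtain t where "t \<in> A \<and> p = x t \<or> t \<in> B \<and> p = y t" using zx zy by force
    then show "p \<in> V" using x y unfolding lipschitz_run_def by blast
  qed
  moreover have "\<forall>t\<in>interior (A \<union> B) - (S \<union> R \<union> {b}).
      \<exists>v\<in>{f1 (?z t), f2 (?z t)}. (?z has_vector_derivative v) (at t)"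
  proof
    fix t assume t: "t \<in> interior (A \<union> B) - (S \<union> R \<union> {b})"
    show "\<exists>v\<in>{f1 (?z t), f2 (?z t)}. (?z has_vector_derivative v) (at t)"
    proof (cases "t < b")
      case True
      have "interior (A \<union> B) \<inter> {..<b} \<subseteq> interior A"
        by (rule interior_maximal) (use b interior_subset[of "A \<union> B"] in \<open>auto simp: subset_iff\<close>)
      then have tA: "t \<in> interior A" using t True by blast
      then obtain v where v: "v \<in> {f1 (x t), f2 (x t)}" "(x has_vector_derivative v) (at t)"
        using S(2) t by blast
      have "(?z has_vector_derivative v) (at t)"
        by (rule has_vector_derivative_transform_within_open[OF v(2) open_interior tA])
          (rule zx[symmetric], use interior_subset in blast)
      then show ?thesis using v(1) True by auto
    next
      case False
      then have "b < t" using t by auto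
      have "interior (A \<union> B) \<inter> {b<..} \<subseteq> interior B"
        by (rule interior_maximal) (use b interior_subset[of "A \<union> B"] in \<open>auto simp: subset_iff\<close>)
      then have tB: "t \<in> interior B" using t \<open>b < t\<close> by blast
      then obtain v where v: "v \<in> {f1 (y t), f2 (y t)}" "(y has_vector_derivative v) (at t)"
        using R(2) t by blast
      have "(?z has_vector_derivative v) (at t)"
        by (rule has_vector_derivative_transform_within_open[OF v(2) open_interior tB])
          (rule zy[symmetric], use interior_subset in blast)
      then show ?thesis using v(1) \<open>b < t\<close> by auto
    qed
  qed
  moreover have "countable (S \<union> R \<union> {b})" using S(1) R(1) by simp
  ultimately show ?thesis unfolding lipschitz_run_def by blast
qed

abbreviation global_run ::
  "('a::real_normed_vector \<Rightarrow> 'a) \<Rightarrow> ('a \<Rightarrow> 'a) \<Rightarrow> 'a set \<Rightarrow> real \<Rightarrow> (real \<Rightarrow> 'a) \<Rightarrow> bool" where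
  "global_run f1 f2 V M v \<equiv> lipschitz_run f1 f2 V M UNIV v"

lemma lipschitz_imp_absolutely_continuous:
  fixes x :: "real \<Rightarrow> 'a::metric_space"
  assumes M: "M-lipschitz_on UNIV x"
  shows "absolutely_continuous_on_interval a b x"
  unfolding absolutely_continuous_on_interval_def
proof (intro allI impI)
  fix e :: real assume "0 < e"
  have M0: "0 \<le> M" using M by (rule lipschitz_on_nonneg)
  show "\<exists>\<delta>>0. \<forall>\<D> T. \<D> division_of T \<and> T \<subseteq> {a..b} \<and> (\<Sum>K\<in>\<D>. Sup K - Inf K) < \<delta> \<longrightarrow>
          (\<Sum>K\<in>\<D>. dist (x (Inf K)) (x (Sup K))) < e"
  proof (intro exI[of _ "e / (M + 1)"] conjI allI impI; (elim conjE)?)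
    show "0 < e / (M + 1)" using \<open>0 < e\<close> M0 by simp
    fix \<D> T assume D: "\<D> division_of T" and small: "(\<Sum>K\<in>\<D>. Sup K - Inf K) < e / (M + 1)"
    have pos: "0 \<le> Sup K - Inf K" if K: "K \<in> \<D>" for K
    proof -
      obtain c d where "K = cbox c d" "K \<noteq> {}"
        using division_ofD(3)[OF D K] division_ofD(4)[OF D K] by blast
      then show ?thesis by simp
    qed
    have "(\<Sum>K\<in>\<D>. dist (x (Inf K)) (x (Sup K))) \<le> (\<Sum>K\<in>\<D>. M * (Sup K - Inf K))"
    proof (rule sum_mono)
      fix K assume "K \<in> \<D>"
      then show "dist (x (Inf K)) (x (Sup K)) \<le> M * (Sup K - Inf K)"
        using lipschitz_onD[OF M, of "Inf K" "Sup K"] pos by (simp add: dist_real_def abs_minus_commute)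
    qed
    also have "\<dots> = M * (\<Sum>K\<in>\<D>. Sup K - Inf K)" by (simp add: sum_distrib_left)
    also have "\<dots> \<le> M * (e / (M + 1))" using small M0 by (intro mult_left_mono) auto
    also have "\<dots> < e" using \<open>0 < e\<close> M0 by (simp add: field_simps)
    finally show "(\<Sum>K\<in>\<D>. dist (x (Inf K)) (x (Sup K))) < e" .
  qed
qed

lemma global_run_solution:
  fixes f1 f2 :: "'a::real_normed_vector \<Rightarrow> 'a"
  assumes "global_run f1 f2 V M v"
  shows "v \<in> inclusion_solutions f1 f2"
proof -
  obtain S where S: "countable S"
     "\<forall>t. t \<notin> S \<longrightarrow> (\<exists>y\<in>{f1 (v t), f2 (v t)}. (v has_vector_derivative y) (at t))"
    using assms unfolding lipschitz_run_def by auto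
  have "S \<in> null_sets lebesgue"
    using S(1) by (simp add: countable_imp_null_set_lborel null_sets_completionI)
  then have "AE t in lebesgue. \<exists>y\<in>{f1 (v t), f2 (v t)}. (v has_vector_derivative y) (at t)"
    by (rule AE_I'[of S]) (use S(2) in auto)
  then show ?thesis
    using assms lipschitz_imp_absolutely_continuous
    unfolding inclusion_solutions_def inclusion_solution_def lipschitz_run_def by blast
qed

lemma periodic_global_run:
  fixes f1 f2 :: "'a::banach \<Rightarrow> 'a"
  assumes run: "switching_run f1 f2 V x a b" and closed: "x a = x b"
    and M: "\<And>p. p \<in> V \<Longrightarrow> norm (f1 p) \<le> M" "\<And>p. p \<in> V \<Longrightarrow> norm (f2 p) \<le> M"
  obtains v where "global_run f1 f2 V M v" "\<And>t. t \<in> {a..b} \<Longrightarrow> v t = x t"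
proof -
  define T where "T = b - a"
  have "a < b" using run unfolding switching_run_def by blast
  then have "0 < T" by (simp add: T_def)
  define v where "v t = x (a + T * frac ((t - a) / T))" for t
  have v_on: "v t = x (t - of_int n * T)" if "t \<in> {a + of_int n * T..b + of_int n * T}" for n t
  proof (cases "t = b + of_int n * T")
    case True
    then have "(t - a) / T = of_int (n + 1)" using \<open>0 < T\<close> by (simp add: T_def field_simps)
    then have "frac ((t - a) / T) = 0" by (metis frac_of_int)
    then have "v t = x a" by (simp only: v_def) simp
    then show ?thesis using True closed by simp
  next
    case False
    then have "frac ((t - a) / T) = (t - a) / T - of_int n"
    proof (intro frac_unique_iff[THEN iffD2] conjI)
      show "0 \<le> (t - a) / T - of_int n" "(t - a) / T - of_int n < 1"
        using that False \<open>0 < T\<close> by (auto simp: field_simps) (simp add: T_def)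
    qed simp
    then have "a + T * frac ((t - a) / T) = t - of_int n * T"
      using \<open>0 < T\<close> by (simp add: field_simps)
    then show ?thesis by (simp only: v_def)
  qed
  have piece: "switching_run f1 f2 V v (a + of_int n * T) (b + of_int n * T)" for n :: int
    by (rule switching_run_cong[OF switching_run_shift[OF run]]) (use v_on in auto)
  have ab: "b + of_int n * T = a + of_int (n + 1) * T" for n :: int
    by (simp add: T_def algebra_simps)
  have cover: "\<exists>n::int. t \<in> {a + of_int n * T..b + of_int n * T}" for t
  proof (intro exI[of _ "\<lfloor>(t - a) / T\<rfloor>"])
    let ?n = "of_int \<lfloor>(t - a) / T\<rfloor> :: real"
    have "?n \<le> (t - a) / T" "(t - a) / T < ?n + 1"
      by linarith+
    then have "?n * T \<le> t - a" "t - a < (?n + 1) * T"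
      using pos_le_divide_eq[OF \<open>0 < T\<close>] pos_divide_less_eq[OF \<open>0 < T\<close>] by blast+
    then show "t \<in> {a + ?n * T..b + ?n * T}"
      by (simp add: T_def algebra_simps)
  qed
  have "global_run f1 f2 V M v"
    unfolding lipschitz_run_def
  proof (intro conjI)
    show "M-lipschitz_on UNIV v"
    proof (rule lipschitz_onI)
      have lip: "M-lipschitz_on {a + of_int n * T..a + of_int (n + 1) * T} v" for n
        using switching_run_lipschitz[OF piece M, of n] unfolding ab .
      then show "0 \<le> M" using lipschitz_on_nonneg by blast
      fix s t :: real
      obtain m n :: int where mn: "s \<in> {a + of_int m * T..b + of_int m * T}"
         "t \<in> {a + of_int n * T..b + of_int n * T}" using cover by meson
      define k where "k = min m n"
      define \<tau> where "\<tau> i = a + of_int (k + int i) * T" for i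
      have lipU: "M-lipschitz_on (\<Union>i. {\<tau> 0..\<tau> i}) v"
      proof (rule lipschitz_on_chain)
        show "M-lipschitz_on {\<tau> i..\<tau> (Suc i)} v" for i
          using lip[of "k + int i"] by (simp add: \<tau>_def add_ac)
        show "\<tau> i \<le> \<tau> (Suc i)" for i
          using \<open>0 < T\<close> by (simp add: \<tau>_def algebra_simps)
      qed
      have inU: "r \<in> (\<Union>i. {\<tau> 0..\<tau> i})"
        if "k \<le> l" "r \<in> {a + of_int l * T..b + of_int l * T}" for l r
      proof (rule UN_I[of "nat (l + 1 - k)"])
        have "of_int k * T \<le> of_int l * T" using that \<open>0 < T\<close> by simp
        then show "r \<in> {\<tau> 0..\<tau> (nat (l + 1 - k))}"
          using that by (auto simp: \<tau>_def ab[of l])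
      qed auto
      show "dist (v s) (v t) \<le> M * dist s t"
        by (rule lipschitz_onD[OF lipU inU[OF _ mn(1)] inU[OF _ mn(2)]]) (simp_all add: k_def)
    qed
    show "range v \<subseteq> V"
      using piece cover unfolding switching_run_def by fastforce
    have "\<forall>n::int. \<exists>S. finite S \<and> (\<forall>t\<in>{a + of_int n * T..b + of_int n * T} - S.
         \<exists>y\<in>{f1 (v t), f2 (v t)}. (v has_vector_derivative y) (at t))"
      using piece unfolding switching_run_def by blast
    then obtain S where S: "\<And>n::int. finite (S n)" "\<And>(n::int) t. t \<in> {a + of_int n * T..b + of_int n * T} - S n \<Longrightarrow>
         \<exists>y\<in>{f1 (v t), f2 (v t)}. (v has_vector_derivative y) (at t)"
      by metis
    show "\<exists>S. countable S \<and>
        (\<forall>t\<in>interior UNIV - S. \<exists>y\<in>{f1 (v t), f2 (v t)}. (v has_vector_derivative y) (at t))"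
    proof (intro exI[of _ "\<Union>n. S n"] conjI ballI)
      show "countable (\<Union>n. S n)" using S(1) by (simp add: countable_finite)
      fix t assume "t \<in> interior UNIV - (\<Union>n. S n)"
      moreover obtain n where "t \<in> {a + of_int n * T..b + of_int n * T}" using cover by blast
      ultimately show "\<exists>y\<in>{f1 (v t), f2 (v t)}. (v has_vector_derivative y) (at t)"
        using S(2)[of t n] by blast
    qed
  qed
  moreover have "v t = x t" if "t \<in> {a..b}" for t
    using v_on[of t 0] that by simp
  ultimately show thesis using that by blast
qed

section \<open>From mutual reachability to the conditions on paths\<close>

lemma simple_path_of_closed_run:
  fixes f1 f2 :: "'a::banach \<Rightarrow> 'a"
  assumes run: "switching_run f1 f2 V x a b" and closed: "x a = x b"
    and M: "\<And>p. p \<in> V \<Longrightarrow> norm (f1 p) \<le> M" "\<And>p. p \<in> V \<Longrightarrow> norm (f2 p) \<le> M"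
    and st: "a \<le> s" "s < t" "t \<le> b" and avoid: "\<And>r. r \<in> {s<..<t} \<Longrightarrow> x r \<noteq> x s \<and> x r \<noteq> x t"
  shows "\<exists>v. simple_path_in (inclusion_solutions f1 f2) V (x s) (x t) v s t"
proof -
  obtain v where v: "global_run f1 f2 V M v" "\<And>t. t \<in> {a..b} \<Longrightarrow> v t = x t"
    using periodic_global_run[OF run closed M] by blast
  have "switching_run f1 f2 V v s t"
    by (rule switching_run_cong[OF switching_run_subinterval[OF run st]]) (use v(2) st in auto)
  then have "v piecewise_C1_differentiable_on {s..t}" "v ` {s..t} \<subseteq> V"
    unfolding switching_run_def by auto
  then show ?thesis
    using global_run_solution[OF v(1)] v(2) st avoid unfolding simple_path_in_def
    by (intro exI[of _ v]) auto
qed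

text \<open>A closed run through \<open>a\<close> and \<open>b\<close> extends to a global solution. If \<open>a\<close> and \<open>b\<close> differ, cut it
at the first visit to \<open>b\<close> and at the last visit to \<open>a\<close> before that; if they agree, cut it at the last
visit to \<open>a\<close> before, and the first visit after, an excursion to another point.\<close>

lemma RS1_if_all_reach:
  fixes f1 f2 :: "'a::banach \<Rightarrow> 'a"
  assumes reach: "\<And>p q. p \<in> V \<Longrightarrow> q \<in> V \<Longrightarrow> reaches f1 f2 V p q"
    and M: "\<And>p. p \<in> V \<Longrightarrow> norm (f1 p) \<le> M" "\<And>p. p \<in> V \<Longrightarrow> norm (f2 p) \<le> M"
    and two: "\<And>p. \<exists>q\<in>V. q \<noteq> p"
  shows "RS1 (inclusion_solutions f1 f2) V"
  unfolding RS1_def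
proof (intro ballI)
  fix a b assume ab: "a \<in> V" "b \<in> V"
  \<comment> \<open>For \<open>a = b\<close> the loop makes a detour through another point.\<close>
  obtain c where c: "c \<in> V" "c \<noteq> a" "a \<noteq> b \<longrightarrow> c = b"
    using two[of a] ab by (cases "a = b") auto
  obtain x T where x: "switching_run f1 f2 V x 0 T" "x 0 = a" "x T = c"
    using reaches_from[OF reach[OF ab(1) c(1)]] .
  obtain y U where y: "switching_run f1 f2 V y T U" "y T = c" "y U = a"
    using reaches_from[OF reach[OF c(1) ab(1)]] .
  define z where "z t = (if t \<le> T then x t else y t)" for t
  have TU: "0 < T" "T < U" using x y unfolding switching_run_def by auto
  have z: "switching_run f1 f2 V z 0 U"
    unfolding z_def using switching_run_join[OF x(1) y(1)] x y by simp
  have zv: "z 0 = a" "z T = c" "z U = a" using x y TU by (auto simp: z_def)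
  have cont: "continuous_on {s..t} z" if "0 \<le> s" "t \<le> U" for s t
    by (rule continuous_on_subset[OF switching_run_continuous[OF z]]) (use that in auto)
  show "\<exists>v s t. simple_path_in (inclusion_solutions f1 f2) V a b v s t"
  proof (cases "a = b")
    case True
    obtain s where s: "s \<in> {0..T}" "z s \<in> {a}" "\<And>r. r \<in> {s<..T} \<Longrightarrow> z r \<notin> {a}"
      by (rule last_hit[OF cont[of 0 T], of "{a}"]) (use TU zv in auto)
    obtain t where t: "t \<in> {T..U}" "z t \<in> {a}" "\<And>r. r \<in> {T..<t} \<Longrightarrow> z r \<notin> {a}"
      by (rule first_hit[OF cont[of T U], of "{a}"]) (use TU zv in auto)
    have "s < T" "T < t" using s t zv c by (auto simp: order_less_le)
    moreover have "z r \<noteq> a" if "r \<in> {s<..<t}" for r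
      using s(3)[of r] t(3)[of r] that by (cases "r \<le> T") auto
    ultimately show ?thesis
      using simple_path_of_closed_run[OF z _ M, of s t] s(1,2) t(1,2) zv True by auto
  next
    case False
    then have "c = b" using c by blast
    obtain t where t: "t \<in> {0..T}" "z t \<in> {b}" "\<And>r. r \<in> {0..<t} \<Longrightarrow> z r \<notin> {b}"
      by (rule first_hit[OF cont[of 0 T], of "{b}"]) (use TU zv \<open>c = b\<close> in auto)
    obtain s where s: "s \<in> {0..t}" "z s \<in> {a}" "\<And>r. r \<in> {s<..t} \<Longrightarrow> z r \<notin> {a}"
      by (rule last_hit[OF cont[of 0 t], of "{a}"]) (use TU zv t in auto)
    have "s < t" using s t False by (auto simp: order_less_le)
    moreover have "z r \<noteq> a \<and> z r \<noteq> b" if "r \<in> {s<..<t}" for r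
      using s(1) s(3)[of r] t(3)[of r] that by auto
    ultimately show ?thesis
      using simple_path_of_closed_run[OF z _ M, of s t] s(1,2) t(1,2) zv TU by auto
  qed
qed

text \<open>A solution satisfies the inclusion almost everywhere only. Where the derivative is continuous, the
set of times at which it is neither \<open>f1\<close> nor \<open>f2\<close> is open, and an open null set is empty; so the
inclusion holds off the finitely many discontinuities.\<close>

lemma simple_path_run:
  fixes f1 f2 :: "'a::real_normed_vector \<Rightarrow> 'a"
  assumes path: "simple_path_in (inclusion_solutions f1 f2) V a b v s t"
    and cont: "continuous_on UNIV f1" "continuous_on UNIV f2"
  shows "switching_run f1 f2 V v s t"
proof -
  have v: "s < t" "v piecewise_C1_differentiable_on {s..t}" "v ` {s..t} \<subseteq> V"
    using path unfolding simple_path_in_def by auto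
  then obtain R D where R: "finite R" "\<forall>r\<in>{s..t} - R. (v has_vector_derivative D r) (at r)"
      "continuous_on ({s..t} - R) D" and cv: "continuous_on {s..t} v"
    unfolding piecewise_C1_differentiable_on_def C1_differentiable_on_def by blast
  have "AE r in lebesgue. \<exists>y\<in>{f1 (v r), f2 (v r)}. (v has_vector_derivative y) (at r)"
    using path unfolding simple_path_in_def inclusion_solutions_def inclusion_solution_def by blast
  then obtain N where N: "N \<in> null_sets lebesgue"
    "{r \<in> space lebesgue. \<not> (\<exists>y\<in>{f1 (v r), f2 (v r)}. (v has_vector_derivative y) (at r))} \<subseteq> N"
    unfolding eventually_ae_filter by blast
  let ?G = "{s<..<t} - R"
  define \<phi> where "\<phi> r = norm (D r - f1 (v r)) * norm (D r - f2 (v r))" for r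
  have "continuous_on ?G D" "continuous_on ?G v"
    by (rule continuous_on_subset[OF R(3)] continuous_on_subset[OF cv]; auto)+
  then have "continuous_on ?G \<phi>"
    unfolding \<phi>_def
    by (intro continuous_intros continuous_on_compose2[OF cont(1)] continuous_on_compose2[OF cont(2)]) auto
  moreover have "open ?G" using R(1) by (simp add: open_Diff finite_imp_closed)
  ultimately have W: "open (?G \<inter> \<phi> -` {0<..})"
    by (rule continuous_open_preimage) auto
  have "?G \<inter> \<phi> -` {0<..} \<subseteq> N"
  proof
    fix r assume r: "r \<in> ?G \<inter> \<phi> -` {0<..}"
    show "r \<in> N"
    proof (rule ccontr)
      assume "r \<notin> N"
      then obtain y where "y \<in> {f1 (v r), f2 (v r)}" "(v has_vector_derivative y) (at r)"
        using N(2) by auto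
      moreover have "(v has_vector_derivative D r) (at r)" using R(2) r by auto
      ultimately have "D r \<in> {f1 (v r), f2 (v r)}"
        using vector_derivative_unique_at by metis
      then show False using r by (auto simp: \<phi>_def)
    qed
  qed
  moreover have "negligible N" using N(1) by (simp add: negligible_iff_null_sets)
  ultimately have "?G \<inter> \<phi> -` {0<..} = {}"
    using W open_not_negligible negligible_subset by metis
  then have "\<phi> r = 0" if "r \<in> ?G" for r
    using that zero_le_mult_iff[of "norm (D r - f1 (v r))"] unfolding \<phi>_def by force
  then have "\<forall>r\<in>{s..t} - (R \<union> {s, t}). \<exists>y\<in>{f1 (v r), f2 (v r)}. (v has_vector_derivative y) (at r)"
    using R(2) unfolding \<phi>_def by force
  moreover have "finite (R \<union> {s, t})" using R(1) by simp
  ultimately show ?thesis using v unfolding switching_run_def by blast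
qed

text \<open>The pieces fit together to a Lipschitz function on the union \<open>I\<close> of the time intervals. It extends
to the closure of \<open>I\<close> with values in the closed set \<open>V\<close>. As every point of \<open>V\<close> reaches itself,
there is a periodic global run through any prescribed point; such runs are attached before the
first time and after the supremum of the times, if that is finite.\<close>

lemma infinite_concatenation:
  fixes f1 f2 :: "'a::banach \<Rightarrow> 'a"
  assumes "closed V"
    and reach: "\<And>p q. p \<in> V \<Longrightarrow> q \<in> V \<Longrightarrow> reaches f1 f2 V p q"
    and M: "\<And>p. p \<in> V \<Longrightarrow> norm (f1 p) \<le> M" "\<And>p. p \<in> V \<Longrightarrow> norm (f2 p) \<le> M"
    and P: "\<And>i. switching_run f1 f2 V (P i) (t i) (t (Suc i))"
    and chain: "\<And>i. P i (t (Suc i)) = P (Suc i) (t (Suc i))"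
  shows "\<exists>\<gamma>. global_run f1 f2 V M \<gamma> \<and> (\<forall>i. \<forall>s\<in>{t i..t (Suc i)}. \<gamma> s = P i s)"
proof -
  have inc: "t i < t (Suc i)" for i using P unfolding switching_run_def by blast
  have mono: "i \<le> j \<Longrightarrow> t i \<le> t j" for i j
    using lift_Suc_mono_le[of t, OF less_imp_le[OF inc]] .
  define x where "x s = P (LEAST i. s \<le> t (Suc i)) s" for s
  have x: "x s = P i s" if s: "s \<in> {t i..t (Suc i)}" for i s
  proof -
    define j where "j = (LEAST i. s \<le> t (Suc i))"
    have j: "s \<le> t (Suc j)" "j \<le> i"
      using LeastI[of "\<lambda>i. s \<le> t (Suc i)" i] Least_le[of "\<lambda>i. s \<le> t (Suc i)" i] s
      by (auto simp: j_def)
    have "P j s = P i s"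
    proof (cases "j = i")
      case False
      then have "Suc j \<le> i" using j by simp
      then have "s = t (Suc j)" "t i = t (Suc j)" using mono[of "Suc j" i] j(1) s by auto
      moreover from this(2) have "i = Suc j"
        using mono[of "Suc (Suc j)" i] inc[of "Suc j"] \<open>Suc j \<le> i\<close> by (cases "i = Suc j") auto
      ultimately show ?thesis using chain[of j] by simp
    qed simp
    then show ?thesis by (simp add: x_def j_def)
  qed
  have run: "switching_run f1 f2 V x (t i) (t (Suc i))" for i
    by (rule switching_run_cong[OF P x])
  define I where "I = (\<Union>i. {t 0..t i})"
  have t0: "t 0 \<in> I" unfolding I_def by auto
  have I_cover: "\<exists>i. s \<in> {t i..t (Suc i)}" if sI: "s \<in> I" for s
  proof -
    obtain n where n: "s \<in> {t 0..t n}" using sI unfolding I_def by blast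
    then have "s \<le> t (Suc n)" using inc[of n] by auto
    define i where "i = (LEAST i. s \<le> t (Suc i))"
    have "s \<le> t (Suc i)" unfolding i_def by (rule LeastI[of _ n]) fact
    moreover have "t i \<le> s"
    proof (cases i)
      case (Suc k)
      then show ?thesis using not_less_Least[of k "\<lambda>i. s \<le> t (Suc i)"] by (auto simp: i_def)
    qed (use n in simp)
    ultimately show ?thesis by auto
  qed
  have I_sub: "{t i..t (Suc i)} \<subseteq> I" for i
    unfolding I_def using mono[of 0 i] by (intro subset_trans[OF _ UN_upper[of "Suc i"]]) auto
  have lip: "M-lipschitz_on I x"
    unfolding I_def using switching_run_lipschitz[OF run M] inc
    by (intro lipschitz_on_chain) (auto intro: less_imp_le)
  have xV: "x ` I \<subseteq> V"
    using I_cover run unfolding switching_run_def by fastforce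
  \<comment> \<open>If the times accumulate, the Lipschitz bound gives the concatenation a limit at the end.\<close>
  obtain g where g: "M-lipschitz_on (closure I) g" "\<And>s. s \<in> I \<Longrightarrow> g s = x s"
    using lipschitz_extend_closure[OF lip] by blast
  have gV: "g ` closure I \<subseteq> V"
    by (rule image_closure_subset[OF lipschitz_on_continuous_on[OF g(1)] \<open>closed V\<close>])
      (use g(2) xV in auto)
  have "convex I"
  proof -
    have "is_interval I"
      unfolding is_interval_1
    proof (intro ballI allI impI)
      fix p q r assume "p \<in> I" "q \<in> I" "p \<le> r \<and> r \<le> q"
      then obtain i where "t 0 \<le> p" "q \<le> t i" "p \<le> r" "r \<le> q" unfolding I_def by auto
      then have "r \<in> {t 0..t i}" by simp
      then show "r \<in> I" unfolding I_def by blast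
    qed
    then show ?thesis by (simp add: is_interval_convex)
  qed
  obtain S where S: "\<And>i. finite (S i)" "\<And>i s. s \<in> {t i..t (Suc i)} - S i \<Longrightarrow>
       \<exists>y\<in>{f1 (x s), f2 (x s)}. (x has_vector_derivative y) (at s)"
    using run unfolding switching_run_def by metis
  have g_run: "lipschitz_run f1 f2 V M (closure I) g"
    unfolding lipschitz_run_def
  proof (intro conjI g gV exI[of _ "\<Union>i. S i"] ballI)
    show "countable (\<Union>i. S i)" using S(1) by (simp add: countable_finite)
    fix s assume s: "s \<in> interior (closure I) - (\<Union>i. S i)"
    then have sI: "s \<in> interior I" using convex_interior_closure[OF \<open>convex I\<close>] by blast
    then obtain i where "s \<in> {t i..t (Suc i)}" using I_cover interior_subset by blast
    then obtain y where y: "y \<in> {f1 (x s), f2 (x s)}" "(x has_vector_derivative y) (at s)"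
      using S(2)[of s i] s by blast
    have gx: "x r = g r" if "r \<in> interior I" for r
      using g(2)[OF subsetD[OF interior_subset that]] by simp
    have "(g has_vector_derivative y) (at s)"
      by (rule has_vector_derivative_transform_within_open[OF y(2) open_interior sI gx])
    then show "\<exists>y\<in>{f1 (g s), f2 (g s)}. (g has_vector_derivative y) (at s)"
      using y(1) gx[OF sI] by auto
  qed
  have through: "\<exists>v. global_run f1 f2 V M v \<and> v s = p" if p: "p \<in> V" for p s
  proof -
    obtain y b where y: "switching_run f1 f2 V y s b" "y s = p" "y b = p"
      using reaches_from[OF reach[OF p p]] .
    obtain v where "global_run f1 f2 V M v" "\<And>t. t \<in> {s..b} \<Longrightarrow> v t = y t"
      using periodic_global_run[OF y(1) _ M] y by auto
    moreover have "s < b" using y unfolding switching_run_def by blast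
    ultimately show ?thesis using y by (intro exI[of _ v]) auto
  qed
  have restrict: "lipschitz_run f1 f2 V M A v" if "global_run f1 f2 V M v" for A v
    using that unfolding lipschitz_run_def by (auto intro: lipschitz_on_subset)
  have I_ge: "closure I \<subseteq> {t 0..}"
    by (rule closure_minimal) (auto simp: I_def)
  have t0c: "t 0 \<in> closure I" using t0 closure_subset by blast
  \<comment> \<open>Any point of \<open>V\<close> lies on a global run, which continues the concatenation after its end.\<close>
  obtain h where h: "lipschitz_run f1 f2 V M {t 0..} h" "\<And>s. s \<in> I \<Longrightarrow> h s = x s"
  proof (cases "bdd_above (range t)")
    case False
    have "{t 0..} \<subseteq> I"
    proof
      fix s assume "s \<in> {t 0..}"
      moreover obtain i where "s \<le> t i"
        using False bdd_aboveI2[of UNIV t s] by (metis linear)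
      ultimately show "s \<in> I" unfolding I_def by auto
    qed
    then have "closure I = {t 0..}" using I_ge closure_subset by blast
    then show thesis using that[of g] g_run g(2) by simp
  next
    case True
    define e where "e = Sup (range t)"
    have le_e: "t i \<le> e" for i using True unfolding e_def by (simp add: cSUP_upper)
    have ce: "closure I \<subseteq> {..e}"
      by (rule closure_minimal) (use le_e in \<open>auto simp: I_def intro: order_trans\<close>)
    have "e \<in> closure (range t)"
      unfolding e_def using True by (intro closure_contains_Sup) auto
    moreover have "range t \<subseteq> I" using I_sub inc by (force simp: less_imp_le)
    ultimately have eI: "e \<in> closure I" using closure_mono by blast
    have "convex (closure I)" using \<open>convex I\<close> by (rule convex_closure)
    then have "is_interval (closure I)" by (simp add: is_interval_convex_1)
    then have "{t 0..e} \<subseteq> closure I"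
      using t0c eI unfolding is_interval_1 by (meson atLeastAtMost_iff subsetI)
    moreover have "{t 0..} = {t 0..e} \<union> {e..}" using le_e[of 0] by auto
    ultimately have union: "closure I \<union> {e..} = {t 0..}" using I_ge by blast
    obtain v where v: "global_run f1 f2 V M v" "v e = g e"
      using through[of "g e" e] gV eI by blast
    have "lipschitz_run f1 f2 V M (closure I \<union> {e..}) (\<lambda>s. if s \<le> e then g s else v s)"
      by (rule lipschitz_run_join[OF g_run restrict[OF v(1)] eI]) (use ce v(2) in auto)
    moreover have "I \<subseteq> {..e}" using ce closure_subset by blast
    ultimately show thesis
      using that[of "\<lambda>s. if s \<le> e then g s else v s"] g(2) unfolding union by (auto simp: subset_iff)
  qed
  have "h (t 0) \<in> V" using h(1) unfolding lipschitz_run_def by auto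
  then obtain u where u: "global_run f1 f2 V M u" "u (t 0) = h (t 0)" using through by blast
  have "lipschitz_run f1 f2 V M ({..t 0} \<union> {t 0..}) (\<lambda>s. if s \<le> t 0 then u s else h s)"
    by (rule lipschitz_run_join[OF restrict[OF u(1)] h(1)]) (use u(2) in auto)
  moreover have "{..t 0} \<union> {t 0..} = UNIV" by auto
  ultimately have "global_run f1 f2 V M (\<lambda>s. if s \<le> t 0 then u s else h s)" by simp
  moreover have "(if s \<le> t 0 then u s else h s) = P i s" if "s \<in> {t i..t (Suc i)}" for i s
  proof -
    have "s \<in> I" using I_sub that by blast
    moreover have "t 0 \<le> s" using mono[of 0 i] that by auto
    ultimately show ?thesis using h(2)[of s] x[OF that] u(2) by auto
  qed
  ultimately show ?thesis by (intro exI[of _ "\<lambda>s. if s \<le> t 0 then u s else h s"]) simp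
qed

lemma BV3_if_all_reach:
  fixes f1 f2 :: "'a::banach \<Rightarrow> 'a"
  assumes "closed V"
    and reach: "\<And>p q. p \<in> V \<Longrightarrow> q \<in> V \<Longrightarrow> reaches f1 f2 V p q"
    and M: "\<And>p. p \<in> V \<Longrightarrow> norm (f1 p) \<le> M" "\<And>p. p \<in> V \<Longrightarrow> norm (f2 p) \<le> M"
    and cont: "continuous_on UNIV f1" "continuous_on UNIV f2"
  shows "BV3 (inclusion_solutions f1 f2) V"
  unfolding BV3_def
proof (intro allI impI, elim conjE)
  fix N :: enat and a t P
  assume "0 < N" and paths: "\<forall>i. enat i < N \<longrightarrow>
      simple_path_in (inclusion_solutions f1 f2) V (a i) (a (Suc i)) (P i) (t i) (t (Suc i))"
  have run: "switching_run f1 f2 V (P i) (t i) (t (Suc i))" if "enat i < N" for i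
    using simple_path_run[OF _ cont] paths that by blast
  have ends: "P i (t i) = a i" "P i (t (Suc i)) = a (Suc i)" if "enat i < N" for i
    using paths that unfolding simple_path_in_def by auto
  show "\<exists>\<gamma>\<in>inclusion_solutions f1 f2. \<forall>i. enat i < N \<longrightarrow> (\<forall>s\<in>{t i..t (Suc i)}. \<gamma> s = P i s)"
  proof (cases N)
    case infinity
    have "\<exists>\<gamma>. global_run f1 f2 V M \<gamma> \<and> (\<forall>i. \<forall>s\<in>{t i..t (Suc i)}. \<gamma> s = P i s)"
      by (rule infinite_concatenation[OF \<open>closed V\<close> reach M]) (simp_all add: run ends infinity)
    then show ?thesis using global_run_solution by blast
  next
    case (enat n)
    \<comment> \<open>Continue a finite sequence by a loop through its end point, run through again and again.\<close>
    obtain m where m: "n = Suc m" using \<open>0 < N\<close> enat by (cases n) (auto simp: zero_enat_def)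
    have "enat m < N" using enat m by simp
    have "P m (t n) \<in> V"
      using run[OF \<open>enat m < N\<close>] m unfolding switching_run_def by auto
    then have "a n \<in> V" using ends(2)[OF \<open>enat m < N\<close>] m by simp
    then obtain y T where y: "switching_run f1 f2 V y 0 T" "y 0 = a n" "y T = a n"
      using reaches_from[OF reach[of "a n" "a n"]] by blast
    define t' where "t' i = (if i \<le> n then t i else t n + real (i - n) * T)" for i
    define P' where "P' i = (if i < n then P i else (\<lambda>s. y (s - t' i)))" for i
    have late: "t' (Suc i) = T + t' i" if "n \<le> i" for i
      using that by (cases "i = n") (auto simp: t'_def Suc_diff_le algebra_simps)
    have run': "switching_run f1 f2 V (P' i) (t' i) (t' (Suc i))" for i
    proof (cases "i < n")
      case True
      then show ?thesis using run[of i] enat by (simp add: P'_def t'_def)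
    next
      case False
      then show ?thesis
        using switching_run_shift[OF y(1), of "t' i"] late[of i] by (simp add: P'_def)
    qed
    have "P' i (t' (Suc i)) = P' (Suc i) (t' (Suc i))" for i
    proof (cases "Suc i < n")
      case True
      then show ?thesis using ends[of i] ends[of "Suc i"] enat by (simp add: P'_def t'_def)
    next
      case False
      show ?thesis
      proof (cases "i < n")
        case True
        then have "n = Suc i" using False by simp
        then show ?thesis using ends(2)[of i] enat y(2) by (simp add: P'_def t'_def)
      next
        case False
        then show ?thesis using late[of i] y by (simp add: P'_def)
      qed
    qed
    from infinite_concatenation[of V f1 f2 M P' t', OF \<open>closed V\<close> reach M run' this]
    obtain \<gamma> where \<gamma>: "global_run f1 f2 V M \<gamma>" "\<forall>i. \<forall>s\<in>{t' i..t' (Suc i)}. \<gamma> s = P' i s"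
      by blast
    have "\<gamma> s = P i s" if "enat i < N" "s \<in> {t i..t (Suc i)}" for i s
    proof -
      have "i < n" using that(1) enat by simp
      then have "t' i = t i" "t' (Suc i) = t (Suc i)" "P' i = P i"
        by (simp_all add: t'_def P'_def)
      then show ?thesis using \<gamma>(2)[rule_format, of s i] that(2) by simp
    qed
    then show ?thesis using global_run_solution[OF \<gamma>(1)] by blast
  qed
qed

section \<open>The filled curve near a hyperbolic singular point\<close>

lemma C1_map_continuous: "C1_map f \<Longrightarrow> continuous_on S f"
  unfolding C1_map_def
  by (meson continuous_at_imp_continuous_on has_derivative_continuous)

lemma C1_map_lipschitz_on:
  fixes f :: "'a::real_normed_vector \<Rightarrow> 'b::real_normed_vector"
  assumes "C1_map f" "compact C" "convex C"
  obtains L where "L-lipschitz_on C f"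
proof -
  obtain f' where f': "\<And>x. (f has_derivative blinfun_apply (f' x)) (at x)" "continuous_on UNIV f'"
    using assms(1) unfolding C1_map_def by blast
  have "compact (f' ` C)"
    using continuous_on_subset[OF f'(2)] assms(2) by (intro compact_continuous_image) auto
  then obtain L where L: "0 < L" "\<And>x. x \<in> C \<Longrightarrow> norm (f' x) \<le> L"
    using compact_imp_bounded bounded_pos by (metis imageI)
  have "L-lipschitz_on C f"
    by (rule bounded_derivative_imp_lipschitz[of C f "\<lambda>x. blinfun_apply (f' x)"])
      (use f'(1) L assms(3) in \<open>auto simp: norm_blinfun.rep_eq[symmetric] intro: has_derivative_at_withinI\<close>)
  then show thesis by (rule that)
qed

text \<open>A real kernel vector of the Jacobian matrix, read as a complex vector, is an eigenvector for the
eigenvalue \<open>0\<close>, whose real part is \<open>0\<close>.\<close>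

lemma hyperbolic_imp_surj_jacobian:
  assumes "hyperbolic_singular_point f a"
  shows "surj (\<lambda>v. jacobian f (at a) *v v)"
proof -
  let ?J = "jacobian f (at a)"
  have "v = 0" if v: "?J *v v = 0" for v
  proof (rule ccontr)
    assume "v \<noteq> 0"
    define u :: "complex^'a" where "u = (\<chi> i. complex_of_real (v $ i))"
    have "(map_matrix complex_of_real ?J *v u) $ i = 0" for i
    proof -
      have "(map_matrix complex_of_real ?J *v u) $ i = complex_of_real ((?J *v v) $ i)"
        by (simp add: u_def map_matrix_def matrix_vector_mult_def)
      then show ?thesis using v by simp
    qed
    then have "map_matrix complex_of_real ?J *v u = 0 *s u"
      by (simp add: vec_eq_iff)
    moreover have "u \<noteq> 0"
      using \<open>v \<noteq> 0\<close> by (auto simp: u_def vec_eq_iff)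
    ultimately have "complex_eigenvalue ?J 0" unfolding complex_eigenvalue_def by blast
    then show False using assms unfolding hyperbolic_singular_point_def by fastforce
  qed
  then have "inj (\<lambda>v. ?J *v v)"
    using linear_injective_0[OF matrix_vector_mul_linear[of ?J]] by blast
  then show ?thesis
    using linear_injective_imp_surjective[OF matrix_vector_mul_linear] by blast
qed

theorem theorem2p3:
  fixes f1 f2 :: "real^2 \<Rightarrow> real^2" and astar :: "real^2" and U :: "(real^2) set"
  assumes "C1_map f1" and "C1_map f2"
    and "hyperbolic_singular_point f1 astar"
    and "open U" and "connected U" and "bounded U" and "astar \<in> U"
    and "no_bounded_solutions_in f2 U"
  shows "\<exists>V :: (real^2) set. V \<noteq> {} \<and>
           \<not> bounded (- V) \<and> connected (- V) \<and>
           RS1 (inclusion_solutions f1 f2) V \<and> BV3 (inclusion_solutions f1 f2) V"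
proof -
  define w where "w = f2 astar"
  have "w \<noteq> 0"
  proof
    assume "w = 0"
    \<comment> \<open>Otherwise the constant curve would be a bounded solution.\<close>
    then have "ode_solution f2 (\<lambda>t. astar)" by (simp add: ode_solution_def w_def)
    then show False
      using assms(7,8) unfolding no_bounded_solutions_in_def by blast
  qed
  \<comment> \<open>\<open>w\<close> turned by a right angle.\<close>
  define n :: "real^2" where "n = vector [- (w $ 2), w $ 1]"
  have n: "n \<bullet> w = 0" "norm n = norm w"
    by (simp_all add: n_def inner_vec_def norm_eq_sqrt_inner sum_2 algebra_simps)
  have span: "v = 0" if "v \<bullet> w = 0" "v \<bullet> n = 0" for v
  proof -
    have a: "v $ 1 * w $ 1 + v $ 2 * w $ 2 = 0" "v $ 2 * w $ 1 - v $ 1 * w $ 2 = 0"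
      using that by (simp_all add: n_def inner_vec_def sum_2)
    have "v $ 1 * (w $ 1 * w $ 1 + w $ 2 * w $ 2) = 0" "v $ 2 * (w $ 1 * w $ 1 + w $ 2 * w $ 2) = 0"
      using a by algebra+
    moreover have "w $ 1 * w $ 1 + w $ 2 * w $ 2 \<noteq> 0"
      using \<open>w \<noteq> 0\<close> by (auto simp: vec_eq_iff forall_2 sum_squares_eq_zero_iff)
    ultimately have "v $ 1 = 0 \<and> v $ 2 = 0" unfolding mult_eq_0_iff by blast
    then show ?thesis by (simp add: vec_eq_iff forall_2)
  qed
  have cont: "continuous_on UNIV f1" "continuous_on UNIV f2"
    using assms(1,2) C1_map_continuous by blast+
  then have cf2: "continuous (at astar) f2" by (simp add: continuous_on_eq_continuous_at)
  have "f1 differentiable at astar"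
    using assms(1) unfolding C1_map_def differentiable_def by blast
  then have d: "(f1 has_derivative (\<lambda>h. jacobian f1 (at astar) *v h)) (at astar)"
    by (simp add: jacobian_works)
  obtain ew en where e: "jacobian f1 (at astar) *v ew = w" "jacobian f1 (at astar) *v en = n"
    using hyperbolic_imp_surj_jacobian[OF assms(3)] by (metis surjD)
  have "0 < norm w / 2" using \<open>w \<noteq> 0\<close> by simp
  then obtain \<delta> where \<delta>: "0 < \<delta>" "\<And>q. dist q astar < \<delta> \<Longrightarrow> dist (f2 q) w < norm w / 2"
    using cf2 unfolding continuous_at_eps_delta w_def by metis
  have speed: "norm w * norm w / 2 \<le> f2 q \<bullet> w" if "q \<in> ball astar \<delta>" for q
  proof -
    have "\<bar>(f2 q - w) \<bullet> w\<bar> \<le> norm (f2 q - w) * norm w" by (rule Cauchy_Schwarz_ineq2)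
    also have "\<dots> \<le> norm w / 2 * norm w"
      using \<delta>(2)[of q] that by (intro mult_right_mono) (auto simp: dist_norm norm_minus_commute)
    finally have "\<bar>f2 q \<bullet> w - norm w * norm w\<bar> \<le> norm w * norm w / 2"
      by (simp add: inner_diff_left dot_square_norm power2_eq_square)
    then show ?thesis unfolding abs_le_iff by linarith
  qed
  obtain p r c p1 p2 where ball: "cball p r \<subseteq> ball astar \<delta>" "0 < c"
      "\<And>q. q \<in> cball p r \<Longrightarrow> f1 q \<bullet> w \<le> - c"
    and p1: "p1 \<in> ball p r" "(f2 p1 \<bullet> n) * (f1 p1 \<bullet> w) < (f1 p1 \<bullet> n) * (f2 p1 \<bullet> w)"
    and p2: "p2 \<in> ball p r" "(f1 p2 \<bullet> n) * (f2 p2 \<bullet> w) < (f2 p2 \<bullet> n) * (f1 p2 \<bullet> w)"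
    by (rule opposed_fields_near_singular_point[OF d _ e cf2 _ \<open>w \<noteq> 0\<close> n \<delta>(1)])
      (use assms(3) in \<open>auto simp: hyperbolic_singular_point_def singular_point_def w_def\<close>)
  let ?C = "cball p r"
  obtain L1 where L1: "L1-lipschitz_on ?C f1"
    by (rule C1_map_lipschitz_on[OF assms(1) compact_cball convex_cball])
  obtain L2 where L2: "L2-lipschitz_on ?C f2"
    by (rule C1_map_lipschitz_on[OF assms(2) compact_cball convex_cball])
  \<comment> \<open>A common lower bound for the speeds of the two fields along \<open>w\<close>.\<close>
  define \<kappa> where "\<kappa> = min c (norm w * norm w / 2)"
  have \<kappa>: "0 < \<kappa>" "\<And>q. q \<in> ?C \<Longrightarrow> f1 q \<bullet> w \<le> - \<kappa>" "\<And>q. q \<in> ?C \<Longrightarrow> \<kappa> \<le> f2 q \<bullet> w"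
  proof -
    show "0 < \<kappa>" using ball(2) \<open>w \<noteq> 0\<close> by (simp add: \<kappa>_def)
    show "f1 q \<bullet> w \<le> - \<kappa>" if "q \<in> ?C" for q using ball(3)[OF that] by (simp add: \<kappa>_def)
    show "\<kappa> \<le> f2 q \<bullet> w" if "q \<in> ?C" for q
      using speed[of q] that ball(1) by (force simp: \<kappa>_def)
  qed
  obtain y T x S where loop: "integral_curve f2 y T" "integral_curve f1 x S" "y T = x 0" "x S = y 0" "y 0 \<noteq> y T"
    "y ` {0..T} \<subseteq> ?C" "x ` {0..S} \<subseteq> ?C"
    by (rule two_field_loop[OF L1 L2 \<kappa> span p1 p2])
  have TS: "0 < T" "0 < S" using loop(1,2) unfolding integral_curve_def by auto
  have run_y: "switching_run f1 f2 ?C y 0 T"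
    by (rule integral_curve_run[OF loop(1) _ cont(2) loop(6)]) simp
  have "switching_run f1 f2 ?C x 0 S"
    by (rule integral_curve_run[OF loop(2) _ cont(1) loop(7)]) simp
  from switching_run_shift[OF this, of T]
  have run_x: "switching_run f1 f2 ?C (\<lambda>t. x (t - T)) T (S + T)" by simp
  define z where "z t = (if t \<le> T then y t else x (t - T))" for t
  have z: "switching_run f1 f2 ?C z 0 (S + T)"
    unfolding z_def by (rule switching_run_join[OF run_y run_x]) (simp add: loop(3))
  have z_ends: "z 0 = y 0" "z T = y T" "z (S + T) = y 0"
    using TS loop(4) by (auto simp: z_def)
  define K where "K = z ` {0..S + T}"
  have K: "compact K" "K \<subseteq> ?C"
    using z compact_continuous_image[OF switching_run_continuous[OF z]]
    unfolding K_def switching_run_def by auto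
  have reach_K: "reaches f1 f2 K a b" if "a \<in> K" "b \<in> K" for a b
    using closed_run_all_reach[OF z _ that[unfolded K_def]] z_ends by (simp add: K_def)
  define V where "V = K \<union> inside K"
  have reach: "reaches f1 f2 V a b" if "a \<in> V" "b \<in> V" for a b
    unfolding V_def
    by (rule filled_all_reach[OF K reach_K compact_cball convex_cball L2 cont(2) \<kappa>(1,3)])
      (use that in \<open>simp_all add: V_def\<close>)
  have V: "- V = outside K" by (simp add: V_def union_with_inside)
  have "- ?C \<subseteq> outside K" using outside_subset_convex[OF convex_cball K(2)] .
  then have VC: "V \<subseteq> ?C" using V by blast
  have "closed V"
    using open_outside[OF compact_imp_closed[OF K(1)]] V by (simp add: closed_def)
  have "compact (f1 ` ?C \<union> f2 ` ?C)"
    by (intro compact_Un compact_continuous_image continuous_on_subset[OF cont(1)]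
        continuous_on_subset[OF cont(2)]) auto
  then obtain M where "\<And>q. q \<in> f1 ` ?C \<union> f2 ` ?C \<Longrightarrow> norm q \<le> M"
    using compact_imp_bounded bounded_iff by metis
  then have M: "\<And>q. q \<in> V \<Longrightarrow> norm (f1 q) \<le> M" "\<And>q. q \<in> V \<Longrightarrow> norm (f2 q) \<le> M"
    using VC by blast+
  have "y 0 \<in> V" "y T \<in> V"
    unfolding V_def K_def z_ends(1,2)[symmetric] using TS by auto
  then have two: "\<exists>q\<in>V. q \<noteq> a" for a using loop(5) by metis
  show ?thesis
  proof (intro exI[of _ V] conjI)
    show "V \<noteq> {}" using \<open>y 0 \<in> V\<close> by blast
    show "\<not> bounded (- V)" "connected (- V)"
      unfolding V using unbounded_outside[OF compact_imp_bounded[OF K(1)]]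
        connected_outside[OF compact_imp_bounded[OF K(1)]] by simp_all
    show "RS1 (inclusion_solutions f1 f2) V" by (rule RS1_if_all_reach[OF reach M two])
    show "BV3 (inclusion_solutions f1 f2) V" by (rule BV3_if_all_reach[OF \<open>closed V\<close> reach M cont])
  qed
qed

end
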